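(* Let $f : \mathbb{R}^n \rightarrow \mathbb{R}$ be semismooth and let $x^* \in \mathbb{R}^n$ be a minimum of order $1$ with constant $\beta > 0$ of $f$. Then $$\liminf_{\xi \in \partial f(x^* + t d'),\, t \searrow 0,\, d' \rightarrow d} \langle \xi, d' \rangle \geq \beta \| d \| \quad \text{for all } d \in \mathbb{R}^n \setminus \{0\}.$$
   Context: $\|\cdot\|$ is the Euclidean norm and $\langle\cdot,\cdot\rangle$ the Euclidean inner product on $\mathbb{R}^n$. Clarke subdifferential: for a locally Lipschitz continuous $f$ with set of non-differentiability points $\Omega$, $\partial f(x)$ is the convex hull of the set of all $\xi \in \mathbb{R}^n$ for which there is a sequence $(y^k)_k$ in $\mathbb{R}^n \setminus \Omega$ with $y^k \to x$ and $\nabla f(y^k) \to \xi$. Semismooth: $f : \mathbb{R}^n \to \mathbb{R}$ is semismooth if it is locally Lipschitz continuous and for all $x, d \in \mathbb{R}^n$ the limit $\lim_{\xi \in \partial f(x + t d'),\, t \searrow 0,\, d' \to d} \langle \xi, d'\rangle$ exists (i.e., $\langle \xi^k, d^k \rangle$ converges to one and the same value for all sequences with $t_k > 0$, $t_k \to 0$, $d^k \to d$, $\xi^k \in \partial f(x + t_k d^k)$). It is a known fact that if $f$ is semismooth, then for all $x,d$ the directional derivative $f'(x,d) = \lim_{t \searrow 0} (f(x+td) - f(x))/t$ exists and equals this limit. Minimum of order $1$: $x^*$ is a minimum of order $1$ with constant $\beta > 0$ of $f$ if there is an open set $U \subseteq \mathbb{R}^n$ with $x^* \in U$ and $f(x)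 \geq f(x^* ) + \beta \|x - x^*\|$ for all $x \in U$. The limit inferior in the claim is the infimum of $\liminf_{k\to\infty} \langle \xi^k, d^k\rangle$ over all sequences with $t_k > 0$, $t_k \to 0$, $d^k \to d$ and $\xi^k \in \partial f(x^* + t_k d^k)$. *)

theory Defs
  imports "HOL-Analysis.Analysis"
begin

definition locally_lipschitz :: "(real ^ 'n \<Rightarrow> real) \<Rightarrow> bool" where
  "locally_lipschitz f \<longleftrightarrow> (\<forall>x. \<exists>u>0. \<exists>L. L-lipschitz_on (cball x u) f)"

text \<open>The library constant \<^const>\<open>local_lipschitz\<close> is about families of functions; for a
  constant family it agrees with the notion above.\<close>

lemma locally_lipschitz_iff_local_lipschitz:
  "locally_lipschitz f \<longleftrightarrow> local_lipschitz (UNIV :: real set) UNIV (\<lambda>_. f)"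
proof
  assume "locally_lipschitz f"
  then show "local_lipschitz (UNIV :: real set) UNIV (\<lambda>_. f)"
    unfolding locally_lipschitz_def local_lipschitz_def by (simp only: Int_UNIV_right) blast
next
  assume l: "local_lipschitz (UNIV :: real set) UNIV (\<lambda>_. f)"
  show "locally_lipschitz f"
    unfolding locally_lipschitz_def
  proof
    fix x
    obtain u L where "u > 0" and L: "\<forall>t \<in> cball (0 :: real) u \<inter> UNIV. L-lipschitz_on (cball x u \<inter> UNIV) f"
      using l unfolding local_lipschitz_def by blast
    then have "0 \<in> cball (0 :: real) u \<inter> UNIV"
      by simp
    with L have "L-lipschitz_on (cball x u \<inter> UNIV) f"
      by (rule bspec)
    with \<open>u > 0\<close> show "\<exists>u>0. \<exists>L. L-lipschitz_on (cball x u) f"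
      by (metis inf_top_right)
  qed
qed

text \<open>Only meaningful at points of differentiability.\<close>

definition gradient :: "(real ^ 'n \<Rightarrow> real) \<Rightarrow> real ^ 'n \<Rightarrow> real ^ 'n" where
  "gradient f x = (THE g. GDERIV f x :> g)"

lemma GDERIV_gradient:
  fixes f :: "real ^ 'n \<Rightarrow> real"
  assumes "f differentiable (at x)"
  shows "GDERIV f x :> gradient f x"
proof -
  obtain D where D: "(f has_derivative D) (at x)"
    using assms unfolding differentiable_def by blast
  then interpret linear D
    using has_derivative_linear by blast
  have "D = (\<lambda>h. h \<bullet> adjoint D 1)"
    using adjoint_works[OF linear_axioms, of _ 1] by auto
  then have *: "GDERIV f x :> adjoint D 1"
    unfolding gderiv_def using has_derivative_eq_rhs[OF D] by blast
  moreover have "g = adjoint D 1" if "GDERIV f x :> g" for g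
  proof -
    have "(\<lambda>h. g \<bullet> h) = (\<lambda>h. adjoint D 1 \<bullet> h)"
      using has_derivative_unique[of f "\<lambda>h. g \<bullet> h" x "\<lambda>h. adjoint D 1 \<bullet> h"] that *
      unfolding gderiv_def by (simp add: inner_commute)
    then have "\<forall>h. g \<bullet> h = adjoint D 1 \<bullet> h"
      by (rule fun_cong[THEN allI])
    then show ?thesis
      by (simp only: vector_eq_rdot)
  qed
  ultimately show ?thesis
    unfolding gradient_def by (rule theI)
qed

definition clarke_subdifferential ::
  "(real ^ 'n \<Rightarrow> real) \<Rightarrow> real ^ 'n \<Rightarrow> (real ^ 'n) set" where
  "clarke_subdifferential f x =
     convex hull {\<xi>. \<exists>y :: nat \<Rightarrow> real ^ 'n.
       (\<forall>k. f differentiable (at (y k))) \<and> y \<longlonglongrightarrow> x \<and> (\<lambda>k. gradient f (y k)) \<longlonglongrightarrow> \<xi>}"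

text \<open>The sequences \<open>(t, d', \<xi>)\<close> along which the limit and the limit inferior over
  \<open>\<xi> \<in> \<partial>f(x + t d')\<close>, \<open>t \<searrow> 0\<close>, \<open>d' \<rightarrow> d\<close> are taken.\<close>

definition clarke_sequences ::
  "(real ^ 'n \<Rightarrow> real) \<Rightarrow> real ^ 'n \<Rightarrow> real ^ 'n \<Rightarrow>
     ((nat \<Rightarrow> real) \<times> (nat \<Rightarrow> real ^ 'n) \<times> (nat \<Rightarrow> real ^ 'n)) set" where
  "clarke_sequences f x d = {(t, d', \<xi>).
     (\<forall>k. t k > 0) \<and> t \<longlonglongrightarrow> 0 \<and> d' \<longlonglongrightarrow> d \<and>
     (\<forall>k. \<xi> k \<in> clarke_subdifferential f (x + t k *\<^sub>R d' k))}"

definition semismooth :: "(real ^ 'n \<Rightarrow> real) \<Rightarrow> bool" where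
  "semismooth f \<longleftrightarrow> locally_lipschitz f \<and>
     (\<forall>x d. \<exists>l. \<forall>(t, d', \<xi>) \<in> clarke_sequences f x d. (\<lambda>k. \<xi> k \<bullet> d' k) \<longlonglongrightarrow> l)"

definition minimum_of_order_1 ::
  "(real ^ 'n \<Rightarrow> real) \<Rightarrow> real \<Rightarrow> real ^ 'n \<Rightarrow> bool" where
  "minimum_of_order_1 f \<beta> xstar \<longleftrightarrow> \<beta> > 0 \<and>
     (\<exists>U. open U \<and> xstar \<in> U \<and> (\<forall>x\<in>U. f x \<ge> f xstar + \<beta> * norm (x - xstar)))"

definition clarke_liminf :: "(real ^ 'n \<Rightarrow> real) \<Rightarrow> real ^ 'n \<Rightarrow> real ^ 'n \<Rightarrow> ereal" where
  "clarke_liminf f x d =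
     (INF (t, d', \<xi>) \<in> clarke_sequences f x d. liminf (\<lambda>k. ereal (\<xi> k \<bullet> d' k)))"

end

theory Submission
  imports Defs
begin

text \<open>Along a ray \<open>x\<^sup>* + s d\<close> the growth condition forces the average slope of \<open>f\<close> over
  \<open>[\<epsilon> b, b]\<close> to be at least \<open>\<beta> \<parallel>d\<parallel> - O(\<epsilon>)\<close>. A mean value argument for averages of \<open>f\<close> over small
  balls, together with Rademacher's theorem, produces a point of differentiability close to the ray
  whose gradient has at least this slope in direction \<open>d\<close>. Gradients lie in the Clarke
  subdifferential, so letting \<open>\<epsilon> \<rightarrow> 0\<close> gives one admissible sequence whose limit is at least
  \<open>\<beta> \<parallel>d\<parallel>\<close>; by semismoothness all admissible sequences share this limit.

  In Rademacher's theorem, Fubini gives directional derivatives almost everywhere from the case of the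
  line; integrating difference quotients over boxes, where translations are harmless in the limit,
  shows that they are additive in the direction almost everywhere; and the Lipschitz bound passes from
  a countable dense set of directions to all of them. On the line, \<open>K x + g(x)\<close> and
  \<open>K x - g(x)\<close> are distribution functions of two measures with sum \<open>2 K \<lambda>\<close>; on the set where
  difference quotients of \<open>g\<close> are frequently above \<open>b\<close> and frequently below \<open>a < b\<close>, Vitali's
  theorem bounds these measures below by \<open>(K + b) \<lambda>\<close> and \<open>(K - a) \<lambda>\<close>, so the set is null.\<close>

subsection \<open>Vitali coverings and interval measures\<close>

text \<open>Vitali's theorem picks countably many disjoint intervals inside \<open>U\<close> that
  cover \<open>E\<close> up to a null set; summing the assumed bound over them gives the claim. No
  sign of \<open>c\<close> enters, since \<open>ennreal\<close> sends negative values to 0.\<close>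

lemma emeasure_ge_of_vitali_cover:
  fixes M :: "real measure"
  assumes sets_M: "sets M = sets borel" and "open U" "E \<subseteq> U" "E \<in> sets borel"
    and cover: "\<And>x \<delta>. x \<in> E \<Longrightarrow> \<delta> > 0 \<Longrightarrow>
      \<exists>u v. u < x \<and> x < v \<and> v - u < \<delta> \<and> ennreal (c * (v - u)) \<le> emeasure M {u..v}"
  shows "ennreal c * emeasure lborel E \<le> emeasure M U"
proof -
  \<comment> \<open>Admissible intervals are indexed by their endpoints; \<open>a\<close> and
    \<open>r\<close> give the centre and radius under which Vitali's theorem sees them as closed
    balls. Containment in \<open>U\<close> is possible at every point of \<open>E\<close> because
    only short intervals matter.\<close>
  define K where "K = {(u, v). u < v \<and> {u..v} \<subseteq> U \<and> ennreal (c * (v - u)) \<le> emeasure M {u..v}}"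
  define a where "a = (\<lambda>(u :: real, v). (u + v) / 2)"
  define r where "r = (\<lambda>(u :: real, v). (v - u) / 2)"
  have cball_eq: "cball (a i) (r i) = {fst i..snd i}" if "i \<in> K" for i
    using that by (auto simp: K_def a_def r_def cball_eq_atLeastAtMost field_simps)
  have r_pos: "0 < r i" if "i \<in> K" for i
    using that by (auto simp: K_def r_def)
  have "\<exists>i. i \<in> K \<and> x \<in> cball (a i) (r i) \<and> r i < \<delta>" if "x \<in> E" "\<delta> > 0" for x \<delta>
  proof -
    obtain e where e: "e > 0" "ball x e \<subseteq> U"
      using \<open>open U\<close> \<open>E \<subseteq> U\<close> \<open>x \<in> E\<close> by (meson openE subsetD)
    obtain u v where uv: "u < x" "x < v" "v - u < min \<delta> e"
      and meas: "ennreal (c * (v - u)) \<le> emeasure M {u..v}"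
      using cover[OF \<open>x \<in> E\<close>, of "min \<delta> e"] e \<open>\<delta> > 0\<close> by auto
    have "{u..v} \<subseteq> ball x e"
      using uv by (auto simp: dist_real_def)
    then have K: "(u, v) \<in> K"
      using uv meas e by (auto simp: K_def)
    then have "x \<in> cball (a (u, v)) (r (u, v))"
      using cball_eq uv by simp
    moreover have "r (u, v) < \<delta>"
      using uv by (simp add: r_def)
    ultimately show ?thesis
      using K by blast
  qed
  then obtain C where C: "countable C" "C \<subseteq> K"
    and disj: "pairwise (\<lambda>i j. disjnt (cball (a i) (r i)) (cball (a j) (r j))) C"
    and negl: "negligible (E - (\<Union>i\<in>C. cball (a i) (r i)))"
    using Vitali_covering_theorem_cballs[of K r E a] r_pos by blast
  define I where "I = (\<lambda>i :: real \<times> real. {fst i..snd i})"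
  have UN_eq: "(\<Union>i\<in>C. cball (a i) (r i)) = (\<Union>i\<in>C. I i)"
    using C(2) by (auto simp: cball_eq I_def subset_iff)
  have disj_I: "disjoint_family_on I C"
    using disj C(2) cball_eq unfolding pairwise_def disjoint_family_on_def I_def disjnt_def
    by (metis subset_iff)
  have [measurable]: "(\<Union>i\<in>C. I i) \<in> sets borel"
    using C(1) by (auto simp: I_def intro!: sets.countable_UN')
  have null: "E - (\<Union>i\<in>C. I i) \<in> null_sets lborel"
    using negl \<open>E \<in> sets borel\<close> by (auto simp: UN_eq negligible_iff_null_sets null_sets_completion_iff)
  have "emeasure lborel E \<le> emeasure lborel ((\<Union>i\<in>C. I i) \<union> (E - (\<Union>i\<in>C. I i)))"
    using \<open>E \<in> sets borel\<close> by (intro emeasure_mono) auto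
  also have "\<dots> = emeasure lborel (\<Union>i\<in>C. I i)"
    using null by (intro emeasure_Un_null_set) auto
  also have "\<dots> = (\<integral>\<^sup>+i. emeasure lborel (I i) \<partial>count_space C)"
    using C(1) disj_I by (intro emeasure_UN_countable) (auto simp: I_def)
  finally have "ennreal c * emeasure lborel E
      \<le> ennreal c * (\<integral>\<^sup>+i. emeasure lborel (I i) \<partial>count_space C)"
    by (intro mult_left_mono) auto
  also have "\<dots> = (\<integral>\<^sup>+i. ennreal c * emeasure lborel (I i) \<partial>count_space C)"
    by (rule nn_integral_cmult[symmetric]) simp
  also have "\<dots> \<le> (\<integral>\<^sup>+i. emeasure M (I i) \<partial>count_space C)"
  proof (rule nn_integral_mono)
    fix i assume "i \<in> space (count_space C)"
    then have "fst i < snd i" "ennreal (c * (snd i - fst i)) \<le> emeasure M (I i)"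
      using C(2) by (auto simp: K_def I_def)
    then show "ennreal c * emeasure lborel (I i) \<le> emeasure M (I i)"
      by (simp add: I_def ennreal_mult''[symmetric])
  qed
  also have "\<dots> = emeasure M (\<Union>i\<in>C. I i)"
    using C(1) disj_I by (intro emeasure_UN_countable[symmetric]) (auto simp: I_def sets_M)
  also have "\<dots> \<le> emeasure M U"
    using C(2) \<open>open U\<close> by (intro emeasure_mono) (auto simp: sets_M K_def I_def subset_iff)
  finally show ?thesis .
qed

lemma emeasure_interval_measure_Ioo:
  fixes F :: "real \<Rightarrow> real"
  assumes mono: "\<And>x y. x \<le> y \<Longrightarrow> F x \<le> F y" and cont: "continuous_on UNIV F" and "a \<le> b"
  shows "emeasure (interval_measure F) {a<..<b} = ennreal (F b - F a)"
proof -
  have "emeasure (interval_measure F) {b} = 0"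
    using emeasure_interval_measure_Icc[of b b F] assms by (auto intro: continuous_on_subset)
  then have null: "{b} \<in> null_sets (interval_measure F)"
    by auto
  have "emeasure (interval_measure F) {a<..<b} = emeasure (interval_measure F) {a<..b}"
  proof (cases "a = b")
    case False
    then have "{a<..b} = {a<..<b} \<union> {b}"
      using \<open>a \<le> b\<close> by auto
    then show ?thesis
      using emeasure_Un_null_set[OF _ null, of "{a<..<b}"] by simp
  qed auto
  also have "\<dots> = ennreal (F b - F a)"
    using assms by (intro emeasure_interval_measure_Ioc)
      (auto simp: continuous_on_eq_continuous_at intro: continuous_at_imp_continuous_within)
  finally show ?thesis .
qed

text \<open>Lebesgue measure is determined by its values on boxes, and on an open interval the two
  measures add up to \<open>c\<close> times the length.\<close>

lemma emeasure_interval_measure_add: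
  fixes F G :: "real \<Rightarrow> real"
  assumes F: "\<And>x y. x \<le> y \<Longrightarrow> F x \<le> F y" "continuous_on UNIV F"
    and G: "\<And>x y. x \<le> y \<Longrightarrow> G x \<le> G y" "continuous_on UNIV G"
    and sum: "\<And>x. F x + G x = c * x" and "c > 0" and A: "A \<in> sets borel"
  shows "emeasure (interval_measure F) A + emeasure (interval_measure G) A = ennreal c * emeasure lborel A"
proof -
  \<comment> \<open>Scaling by \<open>1/c\<close> turns the claim into an equality with
    \<open>lborel\<close> itself, the form that \<open>lborel_eqI\<close> proves.\<close>
  define \<mu> where "\<mu> = (\<lambda>A. ennreal (1/c) * (emeasure (interval_measure F) A + emeasure (interval_measure G) A))"
  define M where "M = measure_of UNIV (sets borel) \<mu>"
  have sets_M: "sets M = sets borel"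
    unfolding M_def by (simp add: sigma_algebra.sets_measure_of_eq sets.sigma_sets_eq[of borel, simplified])
  have emeasure_M: "emeasure M X = \<mu> X" if "X \<in> sets borel" for X
  proof (rule emeasure_measure_of_sigma[of UNIV "sets borel" \<mu>, folded M_def])
    show "sigma_algebra UNIV (sets (borel :: real measure))"
      using sets.sigma_algebra_axioms[of "borel :: real measure"] by simp
    show "positive (sets borel) \<mu>"
      by (simp add: positive_def \<mu>_def)
    show "countably_additive (sets borel) \<mu>"
    proof (rule countably_additiveI)
      fix X :: "nat \<Rightarrow> real set"
      assume X: "range X \<subseteq> sets borel" "disjoint_family X"
      have "(\<Sum>i. \<mu> (X i)) = ennreal (1/c) * ((\<Sum>i. emeasure (interval_measure F) (X i))
              + (\<Sum>i. emeasure (interval_measure G) (X i)))"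
        unfolding \<mu>_def by (subst ennreal_suminf_cmult) (simp add: suminf_add)
      then show "(\<Sum>i. \<mu> (X i)) = \<mu> (\<Union>i. X i)"
        using X by (simp add: suminf_emeasure \<mu>_def)
    qed
  qed fact
  have "lborel = M"
  proof (rule lborel_eqI[OF _ sets_M])
    fix l u :: real
    assume "\<And>b. b \<in> Basis \<Longrightarrow> l \<bullet> b \<le> u \<bullet> b"
    then have "l \<le> u"
      by simp
    have "emeasure M (box l u) = ennreal (1/c) * (ennreal (F u - F l) + ennreal (G u - G l))"
      using \<open>l \<le> u\<close> F G by (simp add: emeasure_M \<mu>_def emeasure_interval_measure_Ioo box_real)
    also have "\<dots> = ennreal (1/c * ((F u - F l) + (G u - G l)))"
      using \<open>c > 0\<close> \<open>l \<le> u\<close> F G by (simp only: ennreal_mult' ennreal_plus diff_ge_0_iff_ge divide_nonneg_nonneg order.strict_implies_order zero_le_one)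
    also have "(F u - F l) + (G u - G l) = c * (u - l)"
      using sum[of u] sum[of l] by (simp add: algebra_simps)
    finally show "emeasure M (box l u) = (\<Prod>b\<in>Basis. (u - l) \<bullet> b)"
      using \<open>c > 0\<close> by simp
  qed
  then have "ennreal c * emeasure lborel A = ennreal c * \<mu> A"
    using emeasure_M[OF A] by simp
  also have "\<dots> = ennreal (c * (1/c)) * (emeasure (interval_measure F) A + emeasure (interval_measure G) A)"
    using \<open>c > 0\<close> unfolding \<mu>_def by (simp only: mult.assoc ennreal_mult')
  finally show ?thesis
    using \<open>c > 0\<close> by simp
qed

subsection \<open>Almost everywhere differentiability on the line\<close>

text \<open>Covering arguments control slopes over intervals with \<open>x\<close> in their
  interior, whereas a derivative needs \<open>x\<close> as an endpoint. Continuity of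
  \<open>g\<close> lets one endpoint move to \<open>x\<close>.\<close>

lemma has_real_derivative_of_straddling_slopes:
  fixes g :: "real \<Rightarrow> real"
  assumes cont: "continuous_on UNIV g"
    and slopes: "\<And>\<epsilon>. \<epsilon> > 0 \<Longrightarrow> \<exists>\<delta>>0. \<forall>u v. u < x \<longrightarrow> x < v \<longrightarrow> v - u < \<delta> \<longrightarrow>
      \<bar>g v - g u - l * (v - u)\<bar> \<le> \<epsilon> * (v - u)"
  shows "(g has_real_derivative l) (at x)"
proof -
  have "\<exists>\<delta>>0. \<forall>h. h \<noteq> 0 \<and> norm (h - 0) < \<delta> \<longrightarrow> norm ((g (x + h) - g x) / h - l) < \<epsilon>"
    if pos: "\<epsilon> > 0" for \<epsilon>
  proof -
    obtain \<delta> where "\<delta> > 0" and \<delta>: "\<And>u v. u < x \<Longrightarrow> x < v \<Longrightarrow> v - u < \<delta> \<Longrightarrow>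
        \<bar>g v - g u - l * (v - u)\<bar> \<le> \<epsilon> / 2 * (v - u)"
      using slopes[OF half_gt_zero[OF pos]] by blast
    have bound: "\<bar>g (x + h) - g x - l * h\<bar> \<le> \<epsilon> / 2 * \<bar>h\<bar>" if "h \<noteq> 0" "\<bar>h\<bar> < \<delta>" for h
    proof (cases "h > 0")
      case True
      \<comment> \<open>The right endpoint \<open>x + h\<close> stays fixed. The bound holds for
        every \<open>u\<close> slightly to the left of \<open>x\<close> and passes to the closure
        point \<open>u = x\<close>.\<close>
      have "\<bar>g (x + h) - g x - l * ((x + h) - x)\<bar> - \<epsilon> / 2 * ((x + h) - x) \<le> 0"
      proof (rule continuous_le_on_closure[where S = "{x + h - \<delta><..<x}" and x = x and
          f = "\<lambda>u. \<bar>g (x + h) - g u - l * ((x + h) - u)\<bar> - \<epsilon> / 2 * ((x + h) - u)"])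
        show "continuous_on (closure {x + h - \<delta><..<x})
            (\<lambda>u. \<bar>g (x + h) - g u - l * ((x + h) - u)\<bar> - \<epsilon> / 2 * ((x + h) - u))"
          by (intro continuous_intros continuous_on_subset[OF cont]) auto
      qed (use that True \<delta>[of _ "x + h"] in \<open>auto simp: closure_greaterThanLessThan\<close>)
      then show ?thesis
        using True by simp
    next
      case False
      have "\<bar>g x - g (x + h) - l * (x - (x + h))\<bar> - \<epsilon> / 2 * (x - (x + h)) \<le> 0"
      proof (rule continuous_le_on_closure[where S = "{x<..<x + h + \<delta>}" and x = x and
          f = "\<lambda>v. \<bar>g v - g (x + h) - l * (v - (x + h))\<bar> - \<epsilon> / 2 * (v - (x + h))"])
        show "continuous_on (closure {x<..<x + h + \<delta>})
            (\<lambda>v. \<bar>g v - g (x + h) - l * (v - (x + h))\<bar> - \<epsilon> / 2 * (v - (x + h)))"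
          by (intro continuous_intros continuous_on_subset[OF cont]) auto
      qed (use that False \<delta>[of "x + h"] in \<open>auto simp: closure_greaterThanLessThan\<close>)
      then show ?thesis
        using False by simp
    qed
    have "norm ((g (x + h) - g x) / h - l) < \<epsilon>" if "h \<noteq> 0" "\<bar>h\<bar> < \<delta>" for h
    proof -
      have "(g (x + h) - g x) / h - l = (g (x + h) - g x - l * h) / h"
        using that by (simp add: field_simps)
      then have "norm ((g (x + h) - g x) / h - l) \<le> \<epsilon> / 2"
        using bound[OF that] that by (simp add: abs_divide divide_le_eq)
      then show ?thesis
        using \<open>\<epsilon> > 0\<close> by simp
    qed
    then show ?thesis
      using \<open>\<delta> > 0\<close> by auto
  qed
  then show ?thesis
    unfolding DERIV_def LIM_eq by blast
qed

text \<open>Truncating negative summands to 0 can only increase the right-hand side.\<close>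

lemma ennreal_add_le: "ennreal (x + y) \<le> ennreal x + ennreal y"
proof -
  have "ennreal (x + y) \<le> ennreal (max 0 x + max 0 y)"
    by (intro ennreal_leI add_mono) auto
  also have "\<dots> = ennreal x + ennreal y"
    by (subst ennreal_plus) (auto simp: max_def ennreal_neg)
  finally show ?thesis .
qed

lemma lipschitz_on_real_abs_le:
  fixes g :: "'a::real_normed_vector \<Rightarrow> real"
  assumes "L-lipschitz_on UNIV g"
  shows "\<bar>g v - g u\<bar> \<le> L * norm (v - u)"
  using lipschitz_onD[OF assms, of v u] by (simp add: dist_norm)

text \<open>Whatever \<open>P\<close> is, each union consists of open intervals and is open, so the
  set is a countable intersection of open sets.\<close>

lemma borel_Union_small_intervals:
  "(\<Inter>n. \<Union>{{u<..<v} | u v. u < v \<and> v - u < inverse (real (Suc n)) \<and> P u v}) \<in> sets (borel :: real measure)"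
  by (intro sets.countable_INT'' borel_open open_Union) auto

theorem lipschitz_real_AE_differentiable:
  fixes g :: "real \<Rightarrow> real"
  assumes lip: "L-lipschitz_on UNIV g"
  shows "AE x in lborel. \<exists>D. (g has_real_derivative D) (at x)"
proof -
  \<comment> \<open>The extra 1 makes \<open>K\<close> positive even for constant \<open>g\<close>,
    as needed when adding the two interval measures and when dividing by
    \<open>2 * K\<close>.\<close>
  define K where "K = L + 1"
  have "L \<ge> 0"
    using lip by (simp add: lipschitz_on_def)
  then have "K > 0"
    by (simp add: K_def)
  have gK: "\<bar>g v - g u\<bar> \<le> K * (v - u)" if "u \<le> v" for u v
  proof -
    have "\<bar>g v - g u\<bar> \<le> L * (v - u)"
      using lipschitz_on_real_abs_le[OF lip, of v u] that by simp
    also have "\<dots> \<le> K * (v - u)"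
      using that by (intro mult_right_mono) (auto simp: K_def)
    finally show ?thesis .
  qed
  have cont: "continuous_on UNIV g"
    using lip by (rule lipschitz_on_continuous_on)
  \<comment> \<open>\<open>A P\<close> collects the points lying inside arbitrarily short intervals
    that satisfy \<open>P\<close>; \<open>AD\<close> and \<open>not_AD\<close> unfold membership and
    its negation.\<close>
  define A where "A = (\<lambda>P. \<Inter>n. \<Union>{{u<..<v} | u v :: real. u < v \<and> v - u < inverse (real (Suc n)) \<and> P u v})"
  have AD: "\<exists>u v. u < x \<and> x < v \<and> v - u < \<delta> \<and> P u v" if "x \<in> A P" "\<delta> > 0" for x \<delta> P
  proof -
    obtain n where n: "inverse (real (Suc n)) < \<delta>"
      using reals_Archimedean \<open>\<delta> > 0\<close> by blast
    have "x \<in> \<Union>{{u<..<v} | u v :: real. u < v \<and> v - u < inverse (real (Suc n)) \<and> P u v}"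
      using \<open>x \<in> A P\<close> by (auto simp only: A_def)
    then obtain u v where "u < x" "x < v" "v - u < inverse (real (Suc n))" "P u v"
      by auto
    with n show ?thesis
      by (meson less_trans)
  qed
  have not_AD: "\<exists>\<delta>>0. \<forall>u v. u < x \<longrightarrow> x < v \<longrightarrow> v - u < \<delta> \<longrightarrow> \<not> P u v" if notin: "x \<notin> A P" for x P
  proof -
    obtain n where n: "x \<notin> \<Union>{{u<..<v} | u v :: real. u < v \<and> v - u < inverse (real (Suc n)) \<and> P u v}"
      using notin unfolding A_def INT_iff by blast
    have "\<forall>u v. u < x \<longrightarrow> x < v \<longrightarrow> v - u < inverse (real (Suc n)) \<longrightarrow> \<not> P u v"
    proof (intro allI impI notI)
      fix u v assume "u < x" "x < v" "v - u < inverse (real (Suc n))" "P u v"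
      then have "x \<in> {u<..<v} \<and> u < v \<and> v - u < inverse (real (Suc n)) \<and> P u v"
        by auto
      with n show False
        by blast
    qed
    then show ?thesis
      by (intro exI[of _ "inverse (real (Suc n))"]) simp
  qed
  \<comment> \<open>For \<open>a < b\<close>, these are the points at which slopes over short
    straddling intervals oscillate across the gap from \<open>a\<close> to \<open>b\<close>.\<close>
  define E where "E = (\<lambda>a b. A (\<lambda>u v. g v - g u \<ge> b * (v - u)) \<inter> A (\<lambda>u v. g v - g u \<le> a * (v - u)))"
  have E_borel [measurable]: "E a b \<in> sets borel" for a b
    unfolding E_def A_def by (intro sets.Int borel_Union_small_intervals)
  define F where "F = (\<lambda>x. K * x + g x)"
  define G where "G = (\<lambda>x. K * x - g x)"
  have F: "F x \<le> F y" and G: "G x \<le> G y" if "x \<le> y" for x y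
    using gK[OF that] by (simp_all add: F_def G_def abs_le_iff right_diff_distrib)
  have F_cont: "continuous_on UNIV F" and G_cont: "continuous_on UNIV G"
    by (auto simp: F_def G_def intro!: continuous_intros cont)
  have E_null: "E a b \<in> null_sets lborel" if "a < b" for a b
  proof -
    \<comment> \<open>Cutting down to a bounded interval makes the measure a real number
      \<open>m\<close>, which can be cancelled.\<close>
    have "E a b \<inter> {-real n..real n} \<in> null_sets lborel" for n
    proof -
      define S where "S = E a b \<inter> {-real n..real n}"
      have [measurable]: "S \<in> sets borel"
        by (simp add: S_def)
      have "emeasure lborel S \<le> emeasure lborel {-real n..real n}"
        by (intro emeasure_mono) (auto simp: S_def)
      then have "emeasure lborel S < \<infinity>"
        by (simp add: le_less_trans[OF _ ennreal_less_top])
      then obtain m where m: "m \<ge> 0" "emeasure lborel S = ennreal m"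
        by (cases "emeasure lborel S") auto
      \<comment> \<open>Take an open \<open>T\<close> containing \<open>S\<close> with at most
        \<open>e\<close> more measure. The Vitali bounds for \<open>F\<close> and \<open>G\<close>
        add up to \<open>(K + b) * m + (K - a) * m\<close>, while the two measures of
        \<open>T\<close> add up to at most \<open>2 * K * (m + e)\<close>.\<close>
      have "(b - a) * m \<le> 2 * K * e" if "e > 0" for e
      proof -
        obtain T where T: "open T" "S \<subseteq> T" "emeasure lebesgue (T - S) < ennreal e"
          using sets_lebesgue_outer_open[of S e] \<open>e > 0\<close> by (metis \<open>S \<in> sets borel\<close> sets_completionI_sets sets_lborel)
        have "emeasure lborel T = emeasure lborel S + emeasure lborel (T - S)"
          using T by (subst plus_emeasure) (auto intro!: arg_cong[where f = "emeasure lborel"])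
        also have "\<dots> \<le> ennreal (m + e)"
          using T m \<open>e > 0\<close> by (auto simp: ennreal_plus intro!: add_left_mono)
        finally have T_le: "emeasure lborel T \<le> ennreal (m + e)" .
        have "ennreal (K + b) * emeasure lborel S \<le> emeasure (interval_measure F) T"
        proof (rule emeasure_ge_of_vitali_cover)
          fix x \<delta> :: real assume "x \<in> S" "\<delta> > 0"
          then obtain u v where uv: "u < x" "x < v" "v - u < \<delta>" "g v - g u \<ge> b * (v - u)"
            using AD[of x _ \<delta>] unfolding S_def E_def by blast
          then have "emeasure (interval_measure F) {u..v} = ennreal (F v - F u)"
            using F F_cont by (intro emeasure_interval_measure_Icc) (auto intro: continuous_on_subset)
          also have "ennreal ((K + b) * (v - u)) \<le> \<dots>"
            using uv by (intro ennreal_leI) (auto simp: F_def algebra_simps)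
          finally show "\<exists>u v. u < x \<and> x < v \<and> v - u < \<delta> \<and>
              ennreal ((K + b) * (v - u)) \<le> emeasure (interval_measure F) {u..v}"
            using uv by blast
        qed (use T in auto)
        moreover have "ennreal (K - a) * emeasure lborel S \<le> emeasure (interval_measure G) T"
        proof (rule emeasure_ge_of_vitali_cover)
          fix x \<delta> :: real assume "x \<in> S" "\<delta> > 0"
          then obtain u v where uv: "u < x" "x < v" "v - u < \<delta>" "g v - g u \<le> a * (v - u)"
            using AD[of x _ \<delta>] unfolding S_def E_def by blast
          then have "emeasure (interval_measure G) {u..v} = ennreal (G v - G u)"
            using G G_cont by (intro emeasure_interval_measure_Icc) (auto intro: continuous_on_subset)
          also have "ennreal ((K - a) * (v - u)) \<le> \<dots>"
            using uv by (intro ennreal_leI) (auto simp: G_def algebra_simps)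
          finally show "\<exists>u v. u < x \<and> x < v \<and> v - u < \<delta> \<and>
              ennreal ((K - a) * (v - u)) \<le> emeasure (interval_measure G) {u..v}"
            using uv by blast
        qed (use T in auto)
        ultimately have "ennreal (K + b) * emeasure lborel S + ennreal (K - a) * emeasure lborel S
            \<le> emeasure (interval_measure F) T + emeasure (interval_measure G) T"
          by (rule add_mono)
        also have "\<dots> = ennreal (2 * K) * emeasure lborel T"
          using F G F_cont G_cont T \<open>K > 0\<close> by (intro emeasure_interval_measure_add) (auto simp: F_def G_def)
        also have "\<dots> \<le> ennreal (2 * K) * ennreal (m + e)"
          using T_le by (intro mult_left_mono) auto
        also have "\<dots> = ennreal (2 * K * (m + e))"
          using \<open>K > 0\<close> by (simp add: ennreal_mult')
        finally have *: "ennreal (K + b) * ennreal m + ennreal (K - a) * ennreal m \<le> ennreal (2 * K * (m + e))"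
          by (simp add: m)
        \<comment> \<open>One of \<open>K + b\<close> and \<open>K - a\<close> may be negative, so
          subadditivity of \<open>ennreal\<close> replaces additivity.\<close>
        have "ennreal ((2 * K + b - a) * m) = ennreal ((K + b) * m + (K - a) * m)"
          by (simp add: algebra_simps)
        also have "\<dots> \<le> ennreal ((K + b) * m) + ennreal ((K - a) * m)"
          by (rule ennreal_add_le)
        also have "\<dots> \<le> ennreal (2 * K * (m + e))"
          using * m by (simp add: ennreal_mult'')
        finally have "(2 * K + b - a) * m \<le> 2 * K * (m + e)"
          using m \<open>K > 0\<close> \<open>e > 0\<close> by (subst (asm) ennreal_le_iff) auto
        then show ?thesis
          by (simp add: algebra_simps)
      qed
      note bound = this
      have "(b - a) * m \<le> 0 + e" if "e > 0" for e
        using bound[of "e / (2 * K)"] that \<open>K > 0\<close> by simp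
      then have "(b - a) * m \<le> 0"
        by (rule field_le_epsilon)
      then have "m = 0"
        using m \<open>a < b\<close> by (simp add: mult_le_0_iff)
      then show ?thesis
        using m by (auto simp: S_def[symmetric])
    qed
    then have "(\<Union>n. E a b \<inter> {-real n..real n}) \<in> null_sets lborel"
      by (intro null_sets_UN) auto
    moreover have "(\<Union>n. E a b \<inter> {-real n..real n}) = E a b"
    proof -
      have "\<exists>n. -real n \<le> x \<and> x \<le> real n" for x
        using real_arch_simple[of "\<bar>x\<bar>"] by (metis abs_le_iff minus_le_iff)
      then show ?thesis
        by auto
    qed
    ultimately show ?thesis
      by simp
  qed
  have null: "(\<Union>(a, b)\<in>{(a, b). a \<in> \<rat> \<and> b \<in> \<rat> \<and> a < b}. E a b) \<in> null_sets lborel"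
  proof (rule null_sets_UN')
    have "countable (\<rat> \<times> (\<rat> :: real set))"
      by (intro countable_SIGMA countable_rat)
    then show "countable {(a :: real, b). a \<in> \<rat> \<and> b \<in> \<rat> \<and> a < b}"
      by (rule countable_subset[rotated]) auto
  qed (use E_null in auto)
  show ?thesis
  proof (rule AE_I'[OF null], intro subsetI, unfold mem_Collect_eq, rule ccontr, erule conjE)
    fix x
    assume notin: "x \<notin> (\<Union>(a, b)\<in>{(a, b). a \<in> \<rat> \<and> b \<in> \<rat> \<and> a < b}. E a b)"
      and not_diff: "\<not> (\<exists>D. (g has_real_derivative D) (at x))"
    \<comment> \<open>\<open>Sup S\<close> is the lower limit of the slopes over intervals shrinking
      to \<open>x\<close>; it is the candidate for the derivative.\<close>
    define S where "S = {a. \<exists>\<delta>>0. \<forall>u v. u < x \<longrightarrow> x < v \<longrightarrow> v - u < \<delta> \<longrightarrow> g v - g u \<ge> a * (v - u)}"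
    have "-K \<in> S"
    proof -
      have "- K * (v - u) \<le> g v - g u" if "u < x" "x < v" for u v
        using F[of u v] that by (simp add: F_def right_diff_distrib)
      then show ?thesis
        by (auto simp: S_def intro!: exI[of _ 1])
    qed
    have S_le: "a \<le> K" if aS: "a \<in> S" for a
    proof -
      obtain \<delta> where "\<delta> > 0" and \<delta>: "\<And>u v. u < x \<Longrightarrow> x < v \<Longrightarrow> v - u < \<delta> \<Longrightarrow> g v - g u \<ge> a * (v - u)"
        using aS by (auto simp: S_def)
      have "a * (\<delta> / 2) \<le> g (x + \<delta> / 4) - g (x - \<delta> / 4)"
        using \<delta>[of "x - \<delta> / 4" "x + \<delta> / 4"] \<open>\<delta> > 0\<close> by simp
      also have "\<dots> \<le> K * (\<delta> / 2)"
        by (rule order_trans[OF abs_ge_self order_trans[OF gK]]) (use \<open>\<delta> > 0\<close> in simp_all)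
      finally show ?thesis
        using \<open>\<delta> > 0\<close> by simp
    qed
    have "bdd_above S"
      using S_le by (auto simp: bdd_above_def)
    have "(g has_real_derivative Sup S) (at x)"
    proof (rule has_real_derivative_of_straddling_slopes[OF cont])
      fix \<epsilon> :: real assume "\<epsilon> > 0"
      obtain a0 where a0: "a0 \<in> S" "Sup S - \<epsilon> < a0"
        using less_cSup_iff[of S "Sup S - \<epsilon>"] \<open>-K \<in> S\<close> \<open>bdd_above S\<close> \<open>\<epsilon> > 0\<close> by auto
      then obtain \<delta>0 where "\<delta>0 > 0" and \<delta>0: "\<And>u v. u < x \<Longrightarrow> x < v \<Longrightarrow> v - u < \<delta>0 \<Longrightarrow> g v - g u \<ge> a0 * (v - u)"
        by (auto simp: S_def)
      \<comment> \<open>Two rationals just above \<open>Sup S\<close>: since \<open>a\<close> is not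
        in \<open>S\<close>, slopes at most \<open>a\<close> recur at every scale. As
        \<open>x\<close> avoids \<open>E a b\<close>, all slopes over short intervals are then below
        \<open>b\<close>, hence below \<open>Sup S + \<epsilon>\<close>.\<close>
      obtain a where a: "a \<in> \<rat>" "Sup S < a" "a < Sup S + \<epsilon>"
        using Rats_dense_in_real[of "Sup S" "Sup S + \<epsilon>"] \<open>\<epsilon> > 0\<close> by auto
      obtain b where b: "b \<in> \<rat>" "a < b" "b < Sup S + \<epsilon>"
        using Rats_dense_in_real[of a "Sup S + \<epsilon>"] a by auto
      have "a \<notin> S"
        using cSup_upper[of a S] \<open>bdd_above S\<close> a by auto
      have "x \<in> A (\<lambda>u v. g v - g u \<le> a * (v - u))"
      proof (rule ccontr)
        assume "x \<notin> A (\<lambda>u v. g v - g u \<le> a * (v - u))"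
        from not_AD[OF this] have "a \<in> S"
          by (auto simp: S_def not_le intro: less_imp_le)
        with \<open>a \<notin> S\<close> show False ..
      qed
      then have "x \<notin> A (\<lambda>u v. g v - g u \<ge> b * (v - u))"
        using notin a b by (auto simp: E_def)
      from not_AD[OF this] obtain \<delta>1 where "\<delta>1 > 0"
        and \<delta>1: "\<And>u v. u < x \<Longrightarrow> x < v \<Longrightarrow> v - u < \<delta>1 \<Longrightarrow> g v - g u < b * (v - u)"
        by (auto simp: not_le)
      have "\<bar>g v - g u - Sup S * (v - u)\<bar> \<le> \<epsilon> * (v - u)"
        if "u < x" "x < v" "v - u < min \<delta>0 \<delta>1" for u v
      proof -
        have "a0 * (v - u) \<le> g v - g u" "g v - g u < b * (v - u)"
          using \<delta>0 \<delta>1 that by auto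
        moreover have "(Sup S - \<epsilon>) * (v - u) \<le> a0 * (v - u)" "b * (v - u) \<le> (Sup S + \<epsilon>) * (v - u)"
          using that a0 b by (auto intro!: mult_right_mono)
        ultimately show ?thesis
          unfolding abs_le_iff by (simp add: algebra_simps)
      qed
      then show "\<exists>\<delta>>0. \<forall>u v. u < x \<longrightarrow> x < v \<longrightarrow> v - u < \<delta> \<longrightarrow>
          \<bar>g v - g u - Sup S * (v - u)\<bar> \<le> \<epsilon> * (v - u)"
        using \<open>\<delta>0 > 0\<close> \<open>\<delta>1 > 0\<close> by (intro exI[of _ "min \<delta>0 \<delta>1"]) auto
    qed
    with not_diff show False
      by blast
  qed
qed

subsection \<open>Directional derivatives of Lipschitz functions\<close>

definition dir_quotient :: "('a::real_normed_vector \<Rightarrow> real) \<Rightarrow> 'a \<Rightarrow> real \<Rightarrow> 'a \<Rightarrow> real" where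
  "dir_quotient f v s x = (f (x + s *\<^sub>R v) - f x) / s"

text \<open>A limit along one fixed sequence is Borel measurable in \<open>x\<close> without further
  argument. Where the two-sided limit exists, \<open>dir_deriv_eqI\<close> identifies the
  two.\<close>

definition dir_deriv :: "('a::real_normed_vector \<Rightarrow> real) \<Rightarrow> 'a \<Rightarrow> 'a \<Rightarrow> real" where
  "dir_deriv f v x = lim (\<lambda>n. dir_quotient f v (inverse (real (Suc n))) x)"

lemma continuous_on_dir_quotient:
  assumes "L-lipschitz_on UNIV f"
  shows "continuous_on UNIV (dir_quotient f v s)"
  unfolding dir_quotient_def using lipschitz_on_continuous_on[OF assms]
  by (cases "s = 0") (auto intro!: continuous_intros continuous_on_compose2[of UNIV f])

lemma borel_measurable_dir_quotient:
  fixes f :: "'a::euclidean_space \<Rightarrow> real"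
  assumes "L-lipschitz_on UNIV f"
  shows "dir_quotient f v s \<in> borel_measurable borel"
  by (rule borel_measurable_continuous_onI[OF continuous_on_dir_quotient[OF assms]])

lemma borel_measurable_dir_deriv:
  fixes f :: "'a::euclidean_space \<Rightarrow> real"
  assumes "L-lipschitz_on UNIV f"
  shows "dir_deriv f v \<in> borel_measurable borel"
  using borel_measurable_dir_quotient[OF assms, measurable] unfolding dir_deriv_def[abs_def]
  by measurable

lemma abs_dir_quotient_le:
  assumes "L-lipschitz_on UNIV f"
  shows "\<bar>dir_quotient f v s x\<bar> \<le> L * norm v"
proof (cases "s = 0")
  case False
  then show ?thesis
    using lipschitz_on_real_abs_le[OF assms, of "x + s *\<^sub>R v" x]
    by (simp add: dir_quotient_def abs_divide divide_le_eq mult_ac)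
qed (use lipschitz_on_nonneg[OF assms] in \<open>simp add: dir_quotient_def\<close>)

lemma dir_deriv_eqI:
  assumes "((\<lambda>s. dir_quotient f v s x) \<longlongrightarrow> l) (at 0)"
  shows "dir_deriv f v x = l"
proof -
  have "filterlim (\<lambda>n. inverse (real (Suc n))) (at 0) sequentially"
    by (intro filterlim_atI LIMSEQ_inverse_real_of_nat) auto
  from filterlim_compose[OF assms this] show ?thesis
    unfolding dir_deriv_def by (rule limI)
qed

lemma abs_dir_deriv_le:
  assumes "L-lipschitz_on UNIV f" and "((\<lambda>s. dir_quotient f v s x) \<longlongrightarrow> dir_deriv f v x) (at 0)"
  shows "\<bar>dir_deriv f v x\<bar> \<le> L * norm v"
  using tendsto_upperbound[OF tendsto_rabs[OF assms(2)]] abs_dir_quotient_le[OF assms(1)]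
  by (simp add: trivial_limit_at)

lemma AE_lborel_translation:
  fixes c :: "'a::euclidean_space"
  assumes "AE x in lborel. P x"
  shows "AE x in lborel. P (x + c)"
proof -
  obtain N where N: "{x. \<not> P x} \<subseteq> N" "N \<in> null_sets lborel"
    using assms by (auto elim!: AE_E simp: null_sets_def)
  have "AE x in distr lborel borel ((+) c). x \<notin> N"
    unfolding lborel_distr_plus using N by (intro AE_not_in)
  moreover have "{x \<in> space borel. x \<notin> N} \<in> sets borel"
    using N by (auto simp: null_sets_def)
  ultimately have "AE x in lborel. c + x \<notin> N"
    by (simp add: AE_distr_iff)
  then show ?thesis
    using N by (auto simp: add.commute elim!: eventually_mono)
qed

text \<open>Fubini requires this measurability. Convergence is the Cauchy condition, and each
  \<open>C m n\<close> is closed: it intersects, over all \<open>s\<close> and \<open>s'\<close>,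
  conditions that are closed because the quotients are continuous in \<open>x\<close>.\<close>

lemma borel_set_dir_quotient_converges:
  fixes f :: "'a::euclidean_space \<Rightarrow> real"
  assumes lip: "L-lipschitz_on UNIV f"
  shows "{x. \<exists>l. ((\<lambda>s. dir_quotient f v s x) \<longlongrightarrow> l) (at 0)} \<in> sets borel"
proof -
  define C where "C = (\<lambda>m n. {x. \<forall>s\<in>{s. s \<noteq> 0 \<and> \<bar>s\<bar> < inverse (real (Suc n))}.
     \<forall>s'\<in>{s. s \<noteq> 0 \<and> \<bar>s\<bar> < inverse (real (Suc n))}.
       \<bar>dir_quotient f v s x - dir_quotient f v s' x\<bar> \<le> inverse (real (Suc m))})"
  have "closed (C m n)" for m n
    unfolding C_def Ball_def using continuous_on_dir_quotient[OF lip]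
    by (intro closed_Collect_all closed_Collect_imp closed_Collect_le open_Collect_const continuous_intros) auto
  then have meas: "(\<Inter>m. \<Union>n. C m n) \<in> sets borel"
    by (intro sets.countable_INT'' sets.countable_UN'' borel_closed) auto
  have "x \<in> (\<Inter>m. \<Union>n. C m n)" if lim: "((\<lambda>s. dir_quotient f v s x) \<longlongrightarrow> l) (at 0)" for x l
  proof
    fix m
    have "inverse (real (Suc m)) / 2 > 0"
      by simp
    with lim obtain \<delta> where "\<delta> > 0" and \<delta>: "\<And>s. s \<noteq> 0 \<Longrightarrow> \<bar>s\<bar> < \<delta> \<Longrightarrow> \<bar>dir_quotient f v s x - l\<bar> < inverse (real (Suc m)) / 2"
      unfolding LIM_eq by (metis diff_zero real_norm_def)
    obtain n where n: "inverse (real (Suc n)) < \<delta>"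
      using reals_Archimedean \<open>\<delta> > 0\<close> by blast
    have "\<bar>dir_quotient f v s x - dir_quotient f v s' x\<bar> \<le> inverse (real (Suc m))"
      if "s \<noteq> 0" "\<bar>s\<bar> < inverse (real (Suc n))" "s' \<noteq> 0" "\<bar>s'\<bar> < inverse (real (Suc n))" for s s'
      using \<delta>[of s] \<delta>[of s'] that n by linarith
    then show "x \<in> (\<Union>n. C m n)"
      by (auto simp: C_def)
  qed
  moreover have "\<exists>l. ((\<lambda>s. dir_quotient f v s x) \<longlongrightarrow> l) (at 0)" if x: "x \<in> (\<Inter>m. \<Union>n. C m n)" for x
  proof -
    have "cauchy_filter (filtermap (\<lambda>s. dir_quotient f v s x) (at 0))"
      unfolding cauchy_filter_metric_filtermap
    proof (intro allI impI)
      fix e :: real assume "e > 0"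
      then obtain m where m: "inverse (real (Suc m)) < e"
        using reals_Archimedean by blast
      obtain n where n: "x \<in> C m n"
        using x by blast
      have "\<forall>\<^sub>F s in at (0::real). s \<noteq> 0 \<and> \<bar>s\<bar> < inverse (real (Suc n))"
        unfolding eventually_at by (intro exI[of _ "inverse (real (Suc n))"]) (auto simp: dist_real_def)
      moreover have "dist (dir_quotient f v s x) (dir_quotient f v s' x) < e"
        if "s \<noteq> 0 \<and> \<bar>s\<bar> < inverse (real (Suc n))" "s' \<noteq> 0 \<and> \<bar>s'\<bar> < inverse (real (Suc n))" for s s'
        using that n m unfolding C_def dist_real_def by fastforce
      ultimately show "\<exists>P. eventually P (at 0) \<and>
          (\<forall>s s'. P s \<and> P s' \<longrightarrow> dist (dir_quotient f v s x) (dir_quotient f v s' x) < e)"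
        by blast
    qed
    then have "\<exists>l. filtermap (\<lambda>s. dir_quotient f v s x) (at 0) \<le> nhds l"
      using cauchy_filter_complete_converges[of "filtermap (\<lambda>s. dir_quotient f v s x) (at 0)" UNIV]
      by (auto simp: complete_UNIV filtermap_bot_iff)
    then show ?thesis
      by (simp add: filterlim_def)
  qed
  ultimately have "{x. \<exists>l. ((\<lambda>s. dir_quotient f v s x) \<longlongrightarrow> l) (at 0)} = (\<Inter>m. \<Union>n. C m n)"
    by blast
  with meas show ?thesis
    by (simp only:)
qed

text \<open>For each \<open>x\<close>, the theorem on the line puts \<open>x + t v\<close> in
  \<open>Q\<close> for almost every \<open>t\<close>. Exchanging the quantifiers by Fubini yields
  one \<open>t\<close> that works for almost every \<open>x\<close>, and translating back by
  \<open>t v\<close> removes it. No choice of coordinates along \<open>v\<close> is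
  involved.\<close>

lemma AE_dir_deriv:
  fixes f :: "'a::euclidean_space \<Rightarrow> real"
  assumes lip: "L-lipschitz_on UNIV f"
  shows "AE x in lborel. ((\<lambda>s. dir_quotient f v s x) \<longlongrightarrow> dir_deriv f v x) (at 0)"
proof -
  define Q where "Q = {x. \<exists>l. ((\<lambda>s. dir_quotient f v s x) \<longlongrightarrow> l) (at 0)}"
  have Q [measurable]: "Q \<in> sets borel"
    unfolding Q_def by (rule borel_set_dir_quotient_converges[OF lip])
  have "AE t in lborel. x + t *\<^sub>R v \<in> Q" for x
  proof -
    have "(L * norm v)-lipschitz_on UNIV (\<lambda>t. f (x + t *\<^sub>R v))"
    proof (rule lipschitz_onI)
      show "dist (f (x + s *\<^sub>R v)) (f (x + t *\<^sub>R v)) \<le> L * norm v * dist s t" for s t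
        using lipschitz_onD[OF lip, of "x + s *\<^sub>R v" "x + t *\<^sub>R v"]
        by (simp add: dist_norm mult_ac flip: scaleR_diff_left)
    qed (use lipschitz_on_nonneg[OF lip] in simp)
    from lipschitz_real_AE_differentiable[OF this] show ?thesis
      by (rule eventually_mono) (auto simp: Q_def DERIV_def dir_quotient_def scaleR_add_left add_ac)
  qed
  then have "AE x in lborel. AE t in (lborel :: real measure). x + t *\<^sub>R v \<in> Q"
    by simp
  then have "AE t in (lborel :: real measure). AE x in lborel. x + t *\<^sub>R v \<in> Q"
    by (subst (asm) lborel_pair.AE_commute) measurable
  then obtain t where t: "AE x in lborel. x + (t::real) *\<^sub>R v \<in> Q"
    using eventually_happens'[of "ae_filter (lborel :: real measure)"]
    by (auto simp: ae_filter_eq_bot_iff)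
  have "AE x in lborel. x \<in> Q"
    using AE_lborel_translation[OF t, of "- t *\<^sub>R v"] by (simp add: add.assoc)
  then show ?thesis
    by (rule eventually_mono) (auto simp: Q_def dir_deriv_eqI)
qed

section \<open>Additivity of the directional derivative in its direction\<close>

text \<open>The density \<open>1 + g / c\<close> is nonnegative almost everywhere and has the same
  box integrals as the density 1, so both define Lebesgue measure; densities are unique almost
  everywhere.\<close>

lemma AE_zero_of_box_integrals:
  fixes g :: "'a::euclidean_space \<Rightarrow> real"
  assumes [measurable]: "g \<in> borel_measurable borel" and bound: "AE x in lborel. \<bar>g x\<bar> \<le> K"
    and zero: "\<And>l u. (\<integral>x. indicator (box l u) x * g x \<partial>lborel) = 0"
  shows "AE x in lborel. g x = 0"
proof -
  define c where "c = \<bar>K\<bar> + 1"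
  have "c > 0"
    by (simp add: c_def)
  have nonneg: "AE x in lborel. 0 \<le> 1 + g x / c"
    using bound by (rule eventually_mono) (use \<open>c > 0\<close> in \<open>auto simp: c_def field_simps\<close>)
  have "lborel = density lborel (\<lambda>x. ennreal (1 + g x / c))"
  proof (rule lborel_eqI)
    fix l u :: 'a
    assume le: "\<And>b. b \<in> Basis \<Longrightarrow> l \<bullet> b \<le> u \<bullet> b"
    have int1: "integrable lborel (indicator (box l u) :: 'a \<Rightarrow> real)"
      by (intro integrable_real_indicator) (auto simp: emeasure_lborel_box_eq)
    have int2: "integrable lborel (\<lambda>x. indicator (box l u) x * g x)"
    proof (rule Bochner_Integration.integrable_bound[OF integrable_mult_left[OF int1, of K]])
      show "AE x in lborel. norm (indicator (box l u) x * g x) \<le> norm (indicator (box l u) x * K)"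
        using bound by (rule eventually_mono) (auto simp: indicator_def)
    qed measurable
    have "emeasure (density lborel (\<lambda>x. ennreal (1 + g x / c))) (box l u)
        = (\<integral>\<^sup>+x. ennreal (1 + g x / c) * indicator (box l u) x \<partial>lborel)"
      by (intro emeasure_density) auto
    also have "\<dots> = (\<integral>\<^sup>+x. ennreal (indicator (box l u) x + (indicator (box l u) x * g x) / c) \<partial>lborel)"
      by (intro nn_integral_cong) (auto simp: indicator_def)
    also have "\<dots> = ennreal (\<integral>x. indicator (box l u) x + (indicator (box l u) x * g x) / c \<partial>lborel)"
      using nonneg by (intro nn_integral_eq_integral Bochner_Integration.integrable_add int1
          Bochner_Integration.integrable_divide int2) (auto simp: indicator_def elim!: eventually_mono)
    also have "(\<integral>x. indicator (box l u) x + (indicator (box l u) x * g x) / c \<partial>lborel)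
        = measure lborel (box l u)"
      using zero[of l u] int1 int2 by simp
    also have "ennreal (measure lborel (box l u)) = (\<Prod>b\<in>Basis. (u - l) \<bullet> b)"
      using le by (simp add: measure_lborel_box_eq)
    finally show "emeasure (density lborel (\<lambda>x. ennreal (1 + g x / c))) (box l u) = (\<Prod>b\<in>Basis. (u - l) \<bullet> b)" .
  qed simp
  then have "density lborel (\<lambda>x. 1) = density lborel (\<lambda>x. ennreal (1 + g x / c))"
    by (simp add: density_1)
  then have "AE x in lborel. 1 = ennreal (1 + g x / c)"
    by (intro sigma_finite_measure.density_unique sigma_finite_lborel) auto
  with nonneg show ?thesis
  proof eventually_elim
    fix x assume "0 \<le> 1 + g x / c" "1 = ennreal (1 + g x / c)"
    then have "1 + g x / c = 1"
      by (metis ennreal_1 ennreal_inj zero_le_one)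
    with \<open>c > 0\<close> show "g x = 0"
      by simp
  qed
qed

lemma AE_not_in_frontier_box:
  fixes a b :: "'a::euclidean_space"
  shows "AE x in lborel. x \<notin> frontier (box a b)"
proof -
  have "frontier (box a b) \<in> null_sets lebesgue"
    using negligible_convex_frontier[OF convex_box(2)] by (auto simp: negligible_iff_null_sets)
  then have "frontier (box a b) \<in> null_sets lborel"
    by (simp add: null_sets_completion_iff borel_closed)
  then show ?thesis
    by (rule AE_not_in)
qed

lemma tendsto_indicator_translate:
  fixes x :: "'a::real_normed_vector"
  assumes "x \<notin> frontier S" and "X \<longlonglongrightarrow> 0"
  shows "(\<lambda>n. indicator S (x + X n) :: real) \<longlonglongrightarrow> indicator S x"
proof (rule tendsto_eventually)
  have lim: "(\<lambda>n. x + X n) \<longlonglongrightarrow> x"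
    using tendsto_add[OF tendsto_const[of x] assms(2)] by simp
  show "\<forall>\<^sub>F n in sequentially. indicator S (x + X n) = (indicator S x :: real)"
  proof (cases "x \<in> interior S")
    case True
    have "\<forall>\<^sub>F n in sequentially. x + X n \<in> interior S"
      using topological_tendstoD[OF lim open_interior True] .
    then show ?thesis
      using True interior_subset[of S] by (auto simp: indicator_def elim!: eventually_mono)
  next
    case False
    then have "x \<in> - closure S"
      using assms(1) by (auto simp: frontier_def)
    then have "\<forall>\<^sub>F n in sequentially. x + X n \<in> - closure S"
      using topological_tendstoD[OF lim, of "- closure S"] by auto
    then show ?thesis
      using \<open>x \<in> - closure S\<close> closure_subset[of S] by (auto simp: indicator_def elim!: eventually_mono)
  qed
qed

lemma lborel_integral_translate:
  fixes h :: "'a::euclidean_space \<Rightarrow> real"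
  assumes [measurable]: "h \<in> borel_measurable borel"
  shows "(\<integral>x. h (x + c) \<partial>lborel) = (\<integral>x. h x \<partial>lborel)"
proof -
  have "(\<integral>x. h x \<partial>lborel) = (\<integral>x. h x \<partial>distr lborel borel ((+) c))"
    unfolding lborel_distr_plus ..
  also have "\<dots> = (\<integral>x. h (c + x) \<partial>lborel)"
    by (intro integral_distr) auto
  finally show ?thesis
    by (simp add: add.commute)
qed

text \<open>The increment is split into a step along \<open>v\<close> from \<open>x\<close> followed
  by a step along \<open>u\<close>. The shifted base point of the second step is the only obstacle
  to additivity in the limit.\<close>

lemma dir_quotient_add:
  "dir_quotient f (u + v) s x = dir_quotient f u s (x + s *\<^sub>R v) + dir_quotient f v s x"
  by (simp add: dir_quotient_def scaleR_add_right add_divide_distrib[symmetric] add_ac)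

text \<open>Integrated over a box, the shift of the base point moves onto the indicator by
  translation invariance. It disappears in the limit, because the shifted indicators converge off
  the null frontier of the box.\<close>

lemma AE_dir_deriv_add:
  fixes f :: "'a::euclidean_space \<Rightarrow> real"
  assumes lip: "L-lipschitz_on UNIV f"
  shows "AE x in lborel. dir_deriv f (u + v) x = dir_deriv f u x + dir_deriv f v x"
proof -
  note [measurable] = borel_measurable_dir_deriv[OF lip] borel_measurable_dir_quotient[OF lip]
  define s where "s = (\<lambda>n. inverse (real (Suc n)))"
  have s_lim: "s \<longlonglongrightarrow> 0"
    unfolding s_def by (rule LIMSEQ_inverse_real_of_nat)
  have s_at: "filterlim s (at 0) sequentially"
    by (intro filterlim_atI s_lim) (auto simp: s_def)
  have AE_bound: "AE x in lborel. \<bar>dir_deriv f w x\<bar> \<le> L * norm w" for w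
    using AE_dir_deriv[OF lip] by (rule eventually_mono) (rule abs_dir_deriv_le[OF lip])
  have AE_lim: "AE x in lborel. (\<lambda>n. dir_quotient f w (s n) x) \<longlonglongrightarrow> dir_deriv f w x" for w
    using AE_dir_deriv[OF lip] by (rule eventually_mono) (rule filterlim_compose[OF _ s_at])
  have "AE x in lborel. dir_deriv f (u + v) x - dir_deriv f u x - dir_deriv f v x = 0"
  proof (rule AE_zero_of_box_integrals)
    show "AE x in lborel. \<bar>dir_deriv f (u + v) x - dir_deriv f u x - dir_deriv f v x\<bar>
        \<le> L * norm (u + v) + L * norm u + L * norm v"
      using AE_bound[of "u + v"] AE_bound[of u] AE_bound[of v] by eventually_elim linarith
    fix a b :: 'a
    define B where "B = box a b"
    obtain R where R: "\<And>x. x \<in> B \<Longrightarrow> norm x \<le> R"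
      using bounded_box[of a b] unfolding B_def bounded_iff by blast
    have [measurable]: "B \<in> sets borel"
      by (simp add: B_def)
    \<comment> \<open>As \<open>s n\<close> is at most 1, this ball contains all the translates of
      \<open>B\<close> by \<open>- s n *\<^sub>R d\<close> with \<open>norm d \<le> norm v\<close>,
      so its indicator dominates all the integrands.\<close>
    have int_ball: "integrable lborel (\<lambda>x. indicator (cball 0 (R + norm v)) x * C :: real)" for C
      by (intro integrable_mult_left integrable_real_indicator)
        (auto simp: emeasure_lborel_cball_finite[unfolded infinity_ennreal_def])
    have int: "integrable lborel (\<lambda>x. indicator B x * h x)"
      if [measurable]: "h \<in> borel_measurable borel" and "AE x in lborel. \<bar>h x\<bar> \<le> C" for h :: "'a \<Rightarrow> real" and C
    proof (rule Bochner_Integration.integrable_bound[OF int_ball[of C]])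
      show "AE x in lborel. norm (indicator B x * h x) \<le> norm (indicator (cball 0 (R + norm v)) x * C)"
        using that(2)
      proof (rule eventually_mono)
        fix x assume "\<bar>h x\<bar> \<le> C"
        moreover have "norm x \<le> R + norm v" if "x \<in> B"
          using R[OF that] norm_ge_zero[of v] by linarith
        ultimately show "norm (indicator B x * h x) \<le> norm (indicator (cball 0 (R + norm v)) x * C)"
          by (auto simp: indicator_def)
      qed
    qed measurable
    \<comment> \<open>The shift \<open>d\<close> is \<open>- v\<close> for the term along
      \<open>u\<close> and 0 for the two unshifted terms.\<close>
    have lim: "(\<lambda>n. \<integral>x. indicator B (x + s n *\<^sub>R d) * dir_quotient f w (s n) x \<partial>lborel)
        \<longlonglongrightarrow> (\<integral>x. indicator B x * dir_deriv f w x \<partial>lborel)" if "norm d \<le> norm v" for d w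
    proof (rule integral_dominated_convergence[where w = "\<lambda>x. indicator (cball 0 (R + norm v)) x * (L * norm w)"])
      show "AE x in lborel. (\<lambda>n. indicator B (x + s n *\<^sub>R d) * dir_quotient f w (s n) x)
          \<longlonglongrightarrow> indicator B x * dir_deriv f w x"
        using AE_lim[of w] AE_not_in_frontier_box[of a b]
      proof eventually_elim
        fix x assume "(\<lambda>n. dir_quotient f w (s n) x) \<longlonglongrightarrow> dir_deriv f w x" "x \<notin> frontier (box a b)"
        moreover have "(\<lambda>n. s n *\<^sub>R d) \<longlonglongrightarrow> 0"
          using tendsto_scaleR[OF s_lim tendsto_const[of d]] by simp
        ultimately show "(\<lambda>n. indicator B (x + s n *\<^sub>R d) * dir_quotient f w (s n) x)
          \<longlonglongrightarrow> indicator B x * dir_deriv f w x"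
          by (intro tendsto_mult tendsto_indicator_translate) (auto simp: B_def)
      qed
      fix n
      have "norm (indicator B (x + s n *\<^sub>R d) * dir_quotient f w (s n) x)
          \<le> indicator (cball 0 (R + norm v)) x * (L * norm w)" for x
      proof (cases "x + s n *\<^sub>R d \<in> B")
        case True
        have "norm x \<le> norm (x + s n *\<^sub>R d) + norm (s n *\<^sub>R d)"
          using norm_triangle_ineq4[of "x + s n *\<^sub>R d" "s n *\<^sub>R d"] by simp
        also have "norm (s n *\<^sub>R d) \<le> norm d"
          by (simp add: s_def field_simps)
        finally have "norm x \<le> R + norm v"
          using R[OF True] that by simp
        then show ?thesis
          using True abs_dir_quotient_le[OF lip] by (simp add: indicator_def)
      qed (use lipschitz_on_nonneg[OF lip] in \<open>simp add: indicator_def\<close>)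
      then show "AE x in lborel. norm (indicator B (x + s n *\<^sub>R d) * dir_quotient f w (s n) x)
          \<le> indicator (cball 0 (R + norm v)) x * (L * norm w)"
        by simp
    qed (use int_ball in measurable)
    have "(\<integral>x. indicator B x * dir_quotient f (u + v) (s n) x \<partial>lborel)
        = (\<integral>x. indicator B (x + s n *\<^sub>R (- v)) * dir_quotient f u (s n) x \<partial>lborel)
          + (\<integral>x. indicator B x * dir_quotient f v (s n) x \<partial>lborel)" for n
    proof -
      have "(\<integral>x. indicator B (x + s n *\<^sub>R (- v)) * dir_quotient f u (s n) x \<partial>lborel)
          = (\<integral>x. indicator B x * dir_quotient f u (s n) (x + s n *\<^sub>R v) \<partial>lborel)"
      proof -
        define h where "h = (\<lambda>x. indicator B (x + s n *\<^sub>R (- v)) * dir_quotient f u (s n) x)"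
        have "h \<in> borel_measurable borel"
          unfolding h_def by measurable
        from lborel_integral_translate[OF this, of "s n *\<^sub>R v"] show ?thesis
          by (simp add: h_def)
      qed
      moreover have "integrable lborel (\<lambda>x. indicator B x * dir_quotient f u (s n) (x + s n *\<^sub>R v))"
        by (rule int[of _ "L * norm u"]) (measurable, simp add: abs_dir_quotient_le[OF lip])
      moreover have "integrable lborel (\<lambda>x. indicator B x * dir_quotient f v (s n) x)"
        by (rule int[of _ "L * norm v"]) (measurable, simp add: abs_dir_quotient_le[OF lip])
      ultimately show ?thesis
        by (simp only: dir_quotient_add distrib_left Bochner_Integration.integral_add)
    qed
    then have "(\<lambda>n. \<integral>x. indicator B x * dir_quotient f (u + v) (s n) x \<partial>lborel)
        \<longlonglongrightarrow> (\<integral>x. indicator B x * dir_deriv f u x \<partial>lborel) + (\<integral>x. indicator B x * dir_deriv f v x \<partial>lborel)"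
      using tendsto_add[OF lim[of "- v" u] lim[of 0 v]] by simp
    with lim[of 0 "u + v"] have eq: "(\<integral>x. indicator B x * dir_deriv f (u + v) x \<partial>lborel)
        = (\<integral>x. indicator B x * dir_deriv f u x \<partial>lborel) + (\<integral>x. indicator B x * dir_deriv f v x \<partial>lborel)"
      by (intro LIMSEQ_unique) simp_all
    have "integrable lborel (\<lambda>x. indicator B x * dir_deriv f w x)" for w
      by (intro int[OF _ AE_bound]) measurable
    then show "(\<integral>x. indicator (box a b) x * (dir_deriv f (u + v) x - dir_deriv f u x - dir_deriv f v x) \<partial>lborel) = 0"
      using eq by (simp add: right_diff_distrib B_def)
  qed measurable
  then show ?thesis
    by (rule eventually_mono) simp
qed

subsection \<open>Rademacher's theorem\<close>

lemma dir_deriv_scaleR: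
  assumes "((\<lambda>s. dir_quotient f v s x) \<longlongrightarrow> dir_deriv f v x) (at 0)"
  shows "dir_deriv f (c *\<^sub>R v) x = c * dir_deriv f v x"
proof (cases "c = 0")
  case True
  then show ?thesis
    by (simp add: dir_deriv_def dir_quotient_def)
next
  case False
  have "filterlim (\<lambda>s. c * s) (at 0) (at 0)"
    using False by (intro filterlim_atI) (auto intro!: tendsto_eq_intros simp: eventually_at_filter)
  from tendsto_mult[OF tendsto_const[of c] filterlim_compose[OF assms this]]
  have "((\<lambda>s. c * dir_quotient f v (c * s) x) \<longlongrightarrow> c * dir_deriv f v x) (at 0)" .
  moreover have "c * dir_quotient f v (c * s) x = dir_quotient f (c *\<^sub>R v) s x" for s
    using False by (simp add: dir_quotient_def mult.commute)
  ultimately show ?thesis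
    by (intro dir_deriv_eqI) simp
qed

text \<open>The exceptional null set depends on the coefficients \<open>c\<close>, so linearity is
  available for countably many directions at once, not for all.\<close>

lemma AE_dir_deriv_sum:
  fixes f :: "'a::euclidean_space \<Rightarrow> real"
  assumes lip: "L-lipschitz_on UNIV f" and "finite S"
  shows "AE x in lborel. dir_deriv f (\<Sum>i\<in>S. c i *\<^sub>R i) x = (\<Sum>i\<in>S. c i * dir_deriv f i x)"
  using \<open>finite S\<close>
proof (induction S)
  case empty
  then show ?case
    by (simp add: dir_deriv_def dir_quotient_def)
next
  case (insert j S)
  from insert.IH AE_dir_deriv[OF lip, of j] AE_dir_deriv_add[OF lip, of "c j *\<^sub>R j" "\<Sum>i\<in>S. c i *\<^sub>R i"]
  show ?case
    by eventually_elim (simp add: insert.hyps dir_deriv_scaleR)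
qed

text \<open>By compactness of the unit sphere, finitely many directions from \<open>Q\<close> come
  close to all unit vectors, so the quotients converge uniformly on them. The Lipschitz bound
  controls the change to a nearby direction.\<close>

lemma lipschitz_has_derivative_of_dense_directions:
  fixes f :: "'a::euclidean_space \<Rightarrow> real"
  assumes lip: "L-lipschitz_on UNIV f"
    and dense: "\<And>U :: 'a set. open U \<Longrightarrow> U \<noteq> {} \<Longrightarrow> \<exists>q\<in>Q. q \<in> U"
    and lim: "\<And>q. q \<in> Q \<Longrightarrow> ((\<lambda>s. dir_quotient f q s x) \<longlongrightarrow> q \<bullet> G) (at 0)"
  shows "(f has_derivative (\<lambda>h. h \<bullet> G)) (at x)"
  unfolding has_derivative_at_alt
proof (intro conjI allI impI bounded_linear_inner_left)
  fix \<epsilon> :: real assume "\<epsilon> > 0"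
  have "L \<ge> 0"
    by (rule lipschitz_on_nonneg[OF lip])
  \<comment> \<open>Replacing a unit vector by a point of \<open>T\<close> within
    \<open>\<eta>\<close> costs \<open>L * \<eta>\<close> for \<open>f\<close> and
    \<open>norm G * \<eta>\<close> for the linear part, per unit of \<open>s\<close>. The 1 keeps
    \<open>N\<close> positive.\<close>
  define N where "N = L + norm G + 1"
  define \<eta> where "\<eta> = \<epsilon> / (2 * N)"
  have "N > 0"
    using \<open>L \<ge> 0\<close> norm_ge_zero[of G] unfolding N_def by linarith
  then have "\<eta> > 0" and \<eta>: "N * \<eta> = \<epsilon> / 2"
    using \<open>\<epsilon> > 0\<close> by (auto simp: \<eta>_def)
  have "sphere 0 1 \<subseteq> (\<Union>q\<in>Q. ball q \<eta>)"
  proof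
    fix w :: 'a
    have "\<exists>q\<in>Q. q \<in> ball w \<eta>"
      using \<open>\<eta> > 0\<close> by (intro dense) auto
    then show "w \<in> (\<Union>q\<in>Q. ball q \<eta>)"
      by (auto simp: dist_commute)
  qed
  then obtain T where T: "T \<subseteq> Q" "finite T" "sphere 0 1 \<subseteq> (\<Union>q\<in>T. ball q \<eta>)"
    using compactE_image[OF compact_sphere, of Q "\<lambda>q. ball q \<eta>" 0 1] by (metis open_ball)
  have "\<forall>\<^sub>F s in at 0. \<forall>q\<in>T. dist (dir_quotient f q s x) (q \<bullet> G) < \<epsilon> / 2"
    using T \<open>\<epsilon> > 0\<close> by (intro eventually_ball_finite ballI tendstoD[OF lim]) auto
  then obtain \<delta> where "\<delta> > 0" and \<delta>: "\<And>s q. s \<noteq> 0 \<Longrightarrow> \<bar>s\<bar> < \<delta> \<Longrightarrow> q \<in> T \<Longrightarrow> \<bar>dir_quotient f q s x - q \<bullet> G\<bar> < \<epsilon> / 2"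
    by (auto simp: eventually_at dist_real_def)
  have "\<bar>f y - f x - (y - x) \<bullet> G\<bar> \<le> \<epsilon> * norm (y - x)" if "norm (y - x) < \<delta>" for y
  proof (cases "y = x")
    case False
    define s where "s = norm (y - x)"
    define w where "w = (y - x) /\<^sub>R s"
    have "s > 0" "s < \<delta>"
      using False that by (auto simp: s_def)
    have y: "y = x + s *\<^sub>R w"
      using \<open>s > 0\<close> by (simp add: w_def)
    have "w \<in> sphere 0 1"
      using \<open>s > 0\<close> by (simp add: w_def s_def)
    then obtain q where q: "q \<in> T" "norm (w - q) < \<eta>"
      using T(3) by (auto simp: dist_norm norm_minus_commute)
    have "\<bar>f (x + s *\<^sub>R w) - f (x + s *\<^sub>R q)\<bar> \<le> L * (s * norm (w - q))"
      using lipschitz_on_real_abs_le[OF lip, of "x + s *\<^sub>R w" "x + s *\<^sub>R q"] \<open>s > 0\<close>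
      by (simp flip: scaleR_diff_right)
    also have "\<dots> \<le> L * (s * \<eta>)"
      using q \<open>s > 0\<close> \<open>L \<ge> 0\<close> by (intro mult_left_mono) auto
    finally have 1: "\<bar>f (x + s *\<^sub>R w) - f (x + s *\<^sub>R q)\<bar> \<le> s * (L * \<eta>)"
      by (simp add: mult_ac)
    have "f (x + s *\<^sub>R q) - f x - s * (q \<bullet> G) = s * (dir_quotient f q s x - q \<bullet> G)"
      using \<open>s > 0\<close> by (simp add: dir_quotient_def field_simps)
    then have 2: "\<bar>f (x + s *\<^sub>R q) - f x - s * (q \<bullet> G)\<bar> \<le> s * (\<epsilon> / 2)"
      using \<delta>[of s q] q \<open>s > 0\<close> \<open>s < \<delta>\<close> by (simp add: abs_mult)
    have "\<bar>(q - w) \<bullet> G\<bar> \<le> norm (q - w) * norm G"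
      by (rule Cauchy_Schwarz_ineq2)
    also have "\<dots> \<le> \<eta> * norm G"
      using q by (intro mult_right_mono) (auto simp: norm_minus_commute)
    finally have "s * \<bar>(q - w) \<bullet> G\<bar> \<le> s * (\<eta> * norm G)"
      using \<open>s > 0\<close> by (intro mult_left_mono) auto
    then have 3: "\<bar>s * (q \<bullet> G) - s * (w \<bullet> G)\<bar> \<le> s * (\<eta> * norm G)"
      using \<open>s > 0\<close> by (simp add: inner_diff_left abs_mult flip: right_diff_distrib)
    have "\<bar>f y - f x - (y - x) \<bullet> G\<bar> \<le> s * (L * \<eta>) + s * (\<epsilon> / 2) + s * (\<eta> * norm G)"
    proof -
      have "f y - f x - (y - x) \<bullet> G = f (x + s *\<^sub>R w) - f x - s * (w \<bullet> G)"
        by (simp add: y)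
      with 1 2 3 show ?thesis
        by linarith
    qed
    also have "\<dots> = s * (N * \<eta> + \<epsilon> / 2 - \<eta>)"
      by (simp add: N_def algebra_simps)
    also have "\<dots> \<le> s * \<epsilon>"
      unfolding \<eta> using \<open>s > 0\<close> \<open>\<eta> > 0\<close> by (intro mult_left_mono) auto
    finally show ?thesis
      by (simp add: s_def mult.commute)
  qed simp
  with \<open>\<delta> > 0\<close> show "\<exists>d>0. \<forall>y. norm (y - x) < d \<longrightarrow> norm (f y - f x - (y - x) \<bullet> G) \<le> \<epsilon> * norm (y - x)"
    by auto
qed

theorem rademacher:
  fixes f :: "'a::euclidean_space \<Rightarrow> real"
  assumes lip: "L-lipschitz_on UNIV f"
  shows "AE x in lborel. f differentiable (at x)"
proof -
  obtain Q :: "'a set" where Q: "countable Q" "\<And>U. open U \<Longrightarrow> U \<noteq> {} \<Longrightarrow> \<exists>q\<in>Q. q \<in> U"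
    by (rule countable_dense_setE) blast
  \<comment> \<open>The only possible gradient; its inner product with \<open>q\<close> is the
    directional derivative along \<open>q\<close> wherever linearity holds for the coordinates of
    \<open>q\<close>.\<close>
  define G where "G = (\<lambda>x. \<Sum>i\<in>Basis. dir_deriv f i x *\<^sub>R i)"
  have "AE x in lborel. ((\<lambda>s. dir_quotient f q s x) \<longlongrightarrow> q \<bullet> G x) (at 0)" for q
    using AE_dir_deriv[OF lip, of q] AE_dir_deriv_sum[OF lip finite_Basis, of "\<lambda>i. q \<bullet> i"]
    by eventually_elim (simp add: G_def inner_sum_right mult.commute euclidean_representation)
  then have "AE x in lborel. \<forall>q\<in>Q. ((\<lambda>s. dir_quotient f q s x) \<longlongrightarrow> q \<bullet> G x) (at 0)"
    using Q(1) by (simp add: AE_ball_countable)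
  then show ?thesis
  proof (rule eventually_mono)
    fix x assume "\<forall>q\<in>Q. ((\<lambda>s. dir_quotient f q s x) \<longlongrightarrow> q \<bullet> G x) (at 0)"
    then have "(f has_derivative (\<lambda>h. h \<bullet> G x)) (at x)"
      using Q(2) by (intro lipschitz_has_derivative_of_dense_directions[OF lip]) auto
    then show "f differentiable (at x)"
      by (auto simp: differentiable_def)
  qed
qed

section \<open>A mean value inequality at nearby points of differentiability\<close>

lemma has_derivative_imp_dir_quotient_tendsto:
  assumes D: "(f has_derivative D) (at x)"
  shows "((\<lambda>s. dir_quotient f v s x) \<longlongrightarrow> D v) (at 0)"
proof -
  have "((\<lambda>s. x + s *\<^sub>R v) has_derivative (\<lambda>s. s *\<^sub>R v)) (at 0)"
    by (auto intro!: derivative_eq_intros)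
  then have "((\<lambda>s. f (x + s *\<^sub>R v)) has_derivative (\<lambda>s. D (s *\<^sub>R v))) (at 0)"
    by (rule has_derivative_compose) (use D in simp)
  moreover have "(\<lambda>s. D (s *\<^sub>R v)) = (\<lambda>s. D v * s)"
    using has_derivative_linear[OF D] by (simp add: linear_cmul mult.commute)
  ultimately have "((\<lambda>s. f (x + s *\<^sub>R v)) has_real_derivative D v) (at 0)"
    by (simp add: has_field_derivative_def)
  then show ?thesis
    by (simp add: DERIV_def dir_quotient_def)
qed

text \<open>The average of \<open>f\<close> over a translated ball is differentiable in the translation, by dominated
  convergence, so the classical mean value theorem applies to it.\<close>

lemma lipschitz_mean_value_nearby:
  fixes f :: "'a::euclidean_space \<Rightarrow> real"
  assumes lip: "L-lipschitz_on UNIV f" and "a < b" "r > 0"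
  obtains s y D where "a < s" "s < b" "norm (y - (p + s *\<^sub>R d)) < r" "(f has_derivative D) (at y)"
    "f (p + b *\<^sub>R d) - f (p + a *\<^sub>R d) - (2 * L + 1) * r \<le> (b - a) * D d"
proof -
  have [measurable]: "f \<in> borel_measurable borel"
    by (rule borel_measurable_continuous_onI[OF lipschitz_on_continuous_on[OF lip]])
  note [measurable] = borel_measurable_dir_deriv[OF lip] borel_measurable_dir_quotient[OF lip]
  define B where "B = ball p r"
  have [measurable]: "B \<in> sets borel"
    by (simp add: B_def)
  have B_fin: "emeasure lborel B < \<infinity>"
    unfolding B_def by (rule emeasure_lborel_ball_finite)
  then have int_B: "integrable lborel (\<lambda>x. indicator B x * C)" for C :: real
    by (intro integrable_mult_left integrable_real_indicator) auto
  have int: "integrable lborel (\<lambda>x. indicator B x * h x)"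
    if [measurable]: "h \<in> borel_measurable borel" and "AE x in lborel. x \<in> B \<longrightarrow> \<bar>h x\<bar> \<le> C" for h :: "'a \<Rightarrow> real" and C
  proof (rule Bochner_Integration.integrable_bound[OF int_B[of C]])
    show "AE x in lborel. norm (indicator B x * h x) \<le> norm (indicator B x * C)"
      using that(2) by (rule eventually_mono) (auto simp: indicator_def)
  qed measurable
  have int_f: "integrable lborel (\<lambda>x. indicator B x * f (x + s *\<^sub>R d))" for s
  proof -
    have "\<bar>f (x + s *\<^sub>R d)\<bar> \<le> \<bar>f (p + s *\<^sub>R d)\<bar> + L * r" if "x \<in> B" for x
    proof -
      have "\<bar>f (x + s *\<^sub>R d) - f (p + s *\<^sub>R d)\<bar> \<le> L * norm (x - p)"
        using lipschitz_on_real_abs_le[OF lip, of "x + s *\<^sub>R d" "p + s *\<^sub>R d"] by simp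
      also have "\<dots> \<le> L * r"
        using that lipschitz_on_nonneg[OF lip]
        by (intro mult_left_mono) (auto simp: B_def dist_norm norm_minus_commute)
      finally show ?thesis
        by linarith
    qed
    then show ?thesis
      by (intro int[of _ "\<bar>f (p + s *\<^sub>R d)\<bar> + L * r"]) auto
  qed
  have AE_lim: "AE x in lborel. ((\<lambda>h. dir_quotient f d h (x + s *\<^sub>R d)) \<longlongrightarrow> dir_deriv f d (x + s *\<^sub>R d)) (at 0)" for s
    by (rule AE_lborel_translation[OF AE_dir_deriv[OF lip]])
  have int_D: "integrable lborel (\<lambda>x. indicator B x * dir_deriv f d (x + s *\<^sub>R d))" for s
    by (rule int[of _ "L * norm d"]) (measurable, use AE_lim in \<open>rule eventually_mono\<close>, use abs_dir_deriv_le[OF lip] in blast)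
  \<comment> \<open>Up to the factor \<open>measure lborel B\<close>, this is the average of
    \<open>f\<close> over the ball of radius \<open>r\<close> around
    \<open>p + s *\<^sub>R d\<close>.\<close>
  define \<Phi> where "\<Phi> = (\<lambda>s. \<integral>x. indicator B x * f (x + s *\<^sub>R d) \<partial>lborel)"
  define \<Phi>' where "\<Phi>' = (\<lambda>s. \<integral>x. indicator B x * dir_deriv f d (x + s *\<^sub>R d) \<partial>lborel)"
  have deriv: "(\<Phi> has_real_derivative \<Phi>' s) (at s)" for s
    unfolding DERIV_def tendsto_at_iff_sequentially
  proof (intro allI impI)
    fix h :: "nat \<Rightarrow> real"
    assume h: "\<forall>n. h n \<in> UNIV - {0}" "h \<longlonglongrightarrow> 0"
    have "(\<lambda>n. \<integral>x. indicator B x * dir_quotient f d (h n) (x + s *\<^sub>R d) \<partial>lborel) \<longlonglongrightarrow> \<Phi>' s"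
      unfolding \<Phi>'_def
    proof (rule integral_dominated_convergence[where w = "\<lambda>x. indicator B x * (L * norm d)"])
      have h_at: "filterlim h (at 0) sequentially"
        using h by (intro filterlim_atI) auto
      show "AE x in lborel. (\<lambda>n. indicator B x * dir_quotient f d (h n) (x + s *\<^sub>R d))
          \<longlonglongrightarrow> indicator B x * dir_deriv f d (x + s *\<^sub>R d)"
        using AE_lim by (rule eventually_mono) (intro tendsto_mult tendsto_const filterlim_compose[OF _ h_at])
      show "AE x in lborel. norm (indicator B x * dir_quotient f d (h n) (x + s *\<^sub>R d))
          \<le> indicator B x * (L * norm d)" for n
        using abs_dir_quotient_le[OF lip, of d] by (intro always_eventually) (auto simp: indicator_def)
    qed (use int_B in measurable)
    moreover have "(\<Phi> (s + h n) - \<Phi> s) / h n = (\<integral>x. indicator B x * dir_quotient f d (h n) (x + s *\<^sub>R d) \<partial>lborel)" for n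
    proof -
      have "(\<Phi> (s + h n) - \<Phi> s) / h n
          = (\<integral>x. (indicator B x * f (x + (s + h n) *\<^sub>R d) - indicator B x * f (x + s *\<^sub>R d)) / h n \<partial>lborel)"
        using int_f[of "s + h n"] int_f[of s] by (simp add: \<Phi>_def)
      also have "\<dots> = (\<integral>x. indicator B x * dir_quotient f d (h n) (x + s *\<^sub>R d) \<partial>lborel)"
        by (intro Bochner_Integration.integral_cong)
          (auto simp: dir_quotient_def scaleR_add_left add.assoc right_diff_distrib)
      finally show ?thesis .
    qed
    ultimately show "((\<lambda>h. (\<Phi> (s + h) - \<Phi> s) / h) \<circ> h) \<longlonglongrightarrow> \<Phi>' s"
      by (simp add: comp_def)
  qed
  obtain z where z: "a < z" "z < b" "\<Phi> b - \<Phi> a = (b - a) * \<Phi>' z"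
    using MVT2[OF \<open>a < b\<close>, of \<Phi> \<Phi>'] deriv by auto
  \<comment> \<open>A lower bound for the increment of \<open>f\<close> between
    \<open>x + a *\<^sub>R d\<close> and \<open>x + b *\<^sub>R d\<close>, for all \<open>x\<close>
    in \<open>B\<close>: each endpoint moves by less than \<open>r\<close>, at a cost of at most
    \<open>L * r\<close>.\<close>
  define c where "c = f (p + b *\<^sub>R d) - f (p + a *\<^sub>R d) - 2 * L * r"
  define m where "m = measure lborel B"
  have "m > 0"
    using \<open>r > 0\<close> unfolding m_def B_def by (simp add: content_ball_pos)
  have int_const: "(\<integral>x. indicator B x * C \<partial>lborel) = m * C" for C :: real
    using B_fin by (simp add: m_def)
  have "m * c = (\<integral>x. indicator B x * c \<partial>lborel)"
    by (rule int_const[symmetric])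
  also have "\<dots> \<le> (\<integral>x. indicator B x * f (x + b *\<^sub>R d) - indicator B x * f (x + a *\<^sub>R d) \<partial>lborel)"
  proof (intro integral_mono int_B Bochner_Integration.integrable_diff int_f)
    fix x
    have "c \<le> f (x + b *\<^sub>R d) - f (x + a *\<^sub>R d)" if "x \<in> B"
    proof -
      have "\<bar>f (x + s *\<^sub>R d) - f (p + s *\<^sub>R d)\<bar> \<le> L * r" for s
      proof -
        have "\<bar>f (x + s *\<^sub>R d) - f (p + s *\<^sub>R d)\<bar> \<le> L * norm (x - p)"
          using lipschitz_on_real_abs_le[OF lip, of "x + s *\<^sub>R d" "p + s *\<^sub>R d"] by simp
        also have "\<dots> \<le> L * r"
          using that lipschitz_on_nonneg[OF lip]
          by (intro mult_left_mono) (auto simp: B_def dist_norm norm_minus_commute)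
        finally show ?thesis .
      qed
      from this[of a] this[of b] show ?thesis
        unfolding c_def by linarith
    qed
    then show "indicator B x * c \<le> indicator B x * f (x + b *\<^sub>R d) - indicator B x * f (x + a *\<^sub>R d)"
      by (auto simp: indicator_def)
  qed
  also have "\<dots> = (b - a) * \<Phi>' z"
    using z(3) int_f by (simp add: \<Phi>_def)
  finally have lower: "m * c \<le> (b - a) * \<Phi>' z" .
  \<comment> \<open>Otherwise almost every slope on the shifted ball is at most
    \<open>(c - r) / (b - a)\<close>, and the average contradicts \<open>lower\<close>. The extra
    \<open>r\<close> supplies the strict gap.\<close>
  have "\<exists>y D. norm (y - (p + z *\<^sub>R d)) < r \<and> (f has_derivative D) (at y) \<and> c - r \<le> (b - a) * D d"
  proof (rule ccontr)
    assume neg: "\<not> ?thesis"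
    have "AE x in lborel. indicator B x * dir_deriv f d (x + z *\<^sub>R d) \<le> indicator B x * ((c - r) / (b - a))"
      using AE_lborel_translation[OF rademacher[OF lip], of "z *\<^sub>R d"]
    proof (rule eventually_mono)
      fix x assume "f differentiable (at (x + z *\<^sub>R d))"
      then obtain D where D: "(f has_derivative D) (at (x + z *\<^sub>R d))"
        by (auto simp: differentiable_def)
      have eq: "dir_deriv f d (x + z *\<^sub>R d) = D d"
        by (intro dir_deriv_eqI has_derivative_imp_dir_quotient_tendsto D)
      have "D d \<le> (c - r) / (b - a)" if "x \<in> B"
      proof -
        have "norm (x + z *\<^sub>R d - (p + z *\<^sub>R d)) < r"
          using that by (simp add: B_def dist_norm norm_minus_commute)
        with neg D have "(b - a) * D d < c - r"
          by (meson not_le)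
        then show ?thesis
          using \<open>a < b\<close> by (simp add: field_simps)
      qed
      then show "indicator B x * dir_deriv f d (x + z *\<^sub>R d) \<le> indicator B x * ((c - r) / (b - a))"
        by (auto simp: indicator_def eq)
    qed
    then have "\<Phi>' z \<le> (\<integral>x. indicator B x * ((c - r) / (b - a)) \<partial>lborel)"
      unfolding \<Phi>'_def by (intro integral_mono_AE int_D int_B)
    then have "(b - a) * \<Phi>' z \<le> m * (c - r)"
      using \<open>a < b\<close> unfolding int_const by (simp add: field_simps)
    with lower have "m * c \<le> m * (c - r)"
      by linarith
    with \<open>m > 0\<close> \<open>r > 0\<close> show False
      by simp
  qed
  then obtain y D where "norm (y - (p + z *\<^sub>R d)) < r" "(f has_derivative D) (at y)" "c - r \<le> (b - a) * D d"
    by blast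
  then show thesis
    using z by (intro that[of z y D]) (auto simp: c_def algebra_simps)
qed

subsection \<open>Order-one minima and the Clarke subdifferential\<close>

lemma has_derivative_gradient:
  fixes f :: "real ^ 'n \<Rightarrow> real"
  assumes "(f has_derivative D) (at x)"
  shows "D h = gradient f x \<bullet> h"
proof -
  have "f differentiable (at x)"
    using assms by (auto simp: differentiable_def)
  then have "(f has_derivative (\<lambda>h. h \<bullet> gradient f x)) (at x)"
    using GDERIV_gradient[of f x] by (simp add: gderiv_def)
  then have "D = (\<lambda>h. h \<bullet> gradient f x)"
    using assms by (rule has_derivative_unique[symmetric])
  then show ?thesis
    by (simp add: inner_commute)
qed

text \<open>The constant sequence at \<open>x\<close> is admissible.\<close>

lemma gradient_in_clarke_subdifferential:
  assumes "f differentiable (at x)"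
  shows "gradient f x \<in> clarke_subdifferential f x"
  unfolding clarke_subdifferential_def
  by (rule hull_inc) (use assms in \<open>auto intro!: exI[of _ "\<lambda>_. x"]\<close>)

text \<open>Projection onto a closed convex set is nonexpansive. This extends a function that is
  Lipschitz on a ball to the whole space, where Rademacher's theorem is stated.\<close>

lemma lipschitz_on_closest_point:
  fixes f :: "'a::euclidean_space \<Rightarrow> 'b::metric_space"
  assumes "L-lipschitz_on S f" "convex S" "closed S" "S \<noteq> {}"
  shows "L-lipschitz_on UNIV (f \<circ> closest_point S)"
proof (rule lipschitz_onI)
  fix x y
  have "dist (f (closest_point S x)) (f (closest_point S y)) \<le> L * dist (closest_point S x) (closest_point S y)"
    using assms by (intro lipschitz_onD[OF assms(1)]) (auto simp: closest_point_in_set)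
  also have "\<dots> \<le> L * dist x y"
    using assms lipschitz_on_nonneg[OF assms(1)] by (intro mult_left_mono closest_point_lipschitz) auto
  finally show "dist ((f \<circ> closest_point S) x) ((f \<circ> closest_point S) y) \<le> L * dist x y"
    by simp
qed (rule lipschitz_on_nonneg[OF assms(1)])

text \<open>Growth is used only at the far end \<open>b\<close> of the segment. The error has four
  sources: \<open>L * norm d * \<epsilon>\<close> from starting at \<open>a\<close> instead of 0,
  the same again from replacing \<open>b - a\<close> by \<open>b\<close>,
  \<open>(2 * L + 1) * \<epsilon>\<close> from the mean value inequality, and
  \<open>L * \<epsilon>\<close> from replacing \<open>d\<close> by \<open>d'\<close>.\<close>

lemma minimum_of_order_1_gradient_nearby:
  fixes f :: "real ^ 'n \<Rightarrow> real"
  assumes lip: "L-lipschitz_on (cball x0 u) f"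
    and minimum: "\<And>x. norm (x - x0) < u \<Longrightarrow> f x \<ge> f x0 + \<beta> * norm (x - x0)"
    and "0 < \<epsilon>" "\<epsilon> < 1" "0 < b" "b * (norm d + 1) < u" "d \<noteq> 0"
  obtains s d' where "0 < s" "s < b" "norm (d' - d) < \<epsilon>" "f differentiable (at (x0 + s *\<^sub>R d'))"
    "\<beta> * norm d - (2 * L * norm d + 3 * L + 1) * \<epsilon> \<le> gradient f (x0 + s *\<^sub>R d') \<bullet> d'"
proof -
  have "L \<ge> 0"
    by (rule lipschitz_on_nonneg[OF lip])
  have "b * (norm d + 1) > 0"
    using \<open>0 < b\<close> norm_ge_zero[of d] by (intro mult_pos_pos) linarith+
  then have "u > 0"
    using \<open>b * (norm d + 1) < u\<close> by linarith
  define F where "F = f \<circ> closest_point (cball x0 u)"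
  have F_lip: "L-lipschitz_on UNIV F"
    unfolding F_def using \<open>u > 0\<close> by (intro lipschitz_on_closest_point lip) auto
  have F_eq: "F x = f x" if "x \<in> cball x0 u" for x
    using that by (simp add: F_def closest_point_self)
  \<comment> \<open>Starting at \<open>a > 0\<close> gives
    \<open>r = \<epsilon> * a < \<epsilon> * s\<close>, so a point within \<open>r\<close> of the
    ray at parameter \<open>s\<close> has, seen from \<open>x0\<close>, a direction within
    \<open>\<epsilon>\<close> of \<open>d\<close>.\<close>
  define a where "a = \<epsilon> * b"
  define r where "r = \<epsilon> * a"
  have "0 < a" "a < b" "0 < r"
    using assms by (auto simp: a_def r_def)
  obtain s y D where s: "a < s" "s < b" and y: "norm (y - (x0 + s *\<^sub>R d)) < r"
    and D: "(F has_derivative D) (at y)"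
    and lower: "F (x0 + b *\<^sub>R d) - F (x0 + a *\<^sub>R d) - (2 * L + 1) * r \<le> (b - a) * D d"
    using lipschitz_mean_value_nearby[OF F_lip \<open>a < b\<close> \<open>0 < r\<close>] by blast
  have "0 < s"
    using s \<open>0 < a\<close> by linarith
  define d' where "d' = (y - x0) /\<^sub>R s"
  have y_eq: "y = x0 + s *\<^sub>R d'"
    using \<open>0 < s\<close> by (simp add: d'_def)
  have "s * norm (d' - d) < r"
    using y \<open>0 < s\<close> by (simp add: y_eq flip: scaleR_diff_right)
  also have "\<dots> < s * \<epsilon>"
    using s \<open>0 < \<epsilon>\<close> by (simp add: r_def mult.commute)
  finally have d': "norm (d' - d) < \<epsilon>"
    using \<open>0 < s\<close> by simp
  have "norm d' \<le> norm d + 1"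
    using d' \<open>\<epsilon> < 1\<close> norm_triangle_ineq2[of d' d] by linarith
  then have "s * norm d' \<le> b * (norm d + 1)"
    using s \<open>0 < s\<close> by (intro mult_mono) auto
  \<comment> \<open>Inside the open ball the extension \<open>F\<close> agrees with
    \<open>f\<close>, so the derivative found for \<open>F\<close> is one of
    \<open>f\<close>.\<close>
  then have y_ball: "y \<in> ball x0 u"
    using \<open>b * (norm d + 1) < u\<close> \<open>0 < s\<close> by (simp add: y_eq dist_norm)
  have f_D: "(f has_derivative D) (at y)"
    by (rule has_derivative_transform_within_open[OF D open_ball y_ball]) (auto intro!: F_eq)
  then have D_eq: "D h = gradient f y \<bullet> h" for h
    by (rule has_derivative_gradient)
  have D_bound: "\<bar>D h\<bar> \<le> L * norm h" for h
    using tendsto_upperbound[OF tendsto_rabs[OF has_derivative_imp_dir_quotient_tendsto[OF D]]]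
      abs_dir_quotient_le[OF F_lip] by simp
  have "f (x0 + b *\<^sub>R d) \<ge> f x0 + \<beta> * norm (x0 + b *\<^sub>R d - x0)"
    using \<open>b * (norm d + 1) < u\<close> \<open>0 < b\<close> by (intro minimum) (simp add: distrib_left)
  then have "F (x0 + b *\<^sub>R d) \<ge> F x0 + b * (\<beta> * norm d)"
    using F_eq[of "x0 + b *\<^sub>R d"] F_eq[of x0] \<open>b * (norm d + 1) < u\<close> \<open>0 < b\<close> \<open>u > 0\<close>
    by (simp add: dist_norm distrib_left mult_ac)
  moreover have "F (x0 + a *\<^sub>R d) \<le> F x0 + a * (L * norm d)"
    using lipschitz_on_real_abs_le[OF F_lip, of "x0 + a *\<^sub>R d" x0] \<open>0 < a\<close> by (simp add: mult_ac)
  moreover have "a * D d \<ge> - (a * (L * norm d))"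
  proof -
    have "- (L * norm d) \<le> D d"
      using D_bound[of d] by linarith
    from mult_left_mono[OF this, of a] show ?thesis
      using \<open>0 < a\<close> by simp
  qed
  moreover have "(2 * L + 1) * r \<le> b * ((2 * L + 1) * \<epsilon>)"
  proof -
    have "(2 * L + 1) * r \<le> (2 * L + 1) * (\<epsilon> * b)"
      using \<open>L \<ge> 0\<close> \<open>a < b\<close> \<open>0 < \<epsilon>\<close> unfolding r_def by (intro mult_left_mono) auto
    then show ?thesis
      by (simp add: mult_ac)
  qed
  ultimately have "b * (\<beta> * norm d) - 2 * (a * (L * norm d)) - b * ((2 * L + 1) * \<epsilon>) \<le> b * D d"
    using lower by (simp add: left_diff_distrib)
  then have "b * (\<beta> * norm d - 2 * \<epsilon> * L * norm d - (2 * L + 1) * \<epsilon>) \<le> b * D d"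
    by (simp add: a_def algebra_simps)
  then have "\<beta> * norm d - 2 * \<epsilon> * L * norm d - (2 * L + 1) * \<epsilon> \<le> D d"
    using \<open>0 < b\<close> by simp
  moreover have "D (d' - d) \<ge> - (L * \<epsilon>)"
    using D_bound[of "d' - d"] mult_left_mono[OF less_imp_le[OF d'] \<open>L \<ge> 0\<close>] by linarith
  moreover have "D d' = D d + D (d' - d)"
    by (simp add: D_eq inner_diff_right)
  ultimately have "\<beta> * norm d - (2 * L * norm d + 3 * L + 1) * \<epsilon> \<le> gradient f (x0 + s *\<^sub>R d') \<bullet> d'"
    unfolding D_eq[of d', symmetric, unfolded y_eq] by (simp add: algebra_simps)
  moreover have "f differentiable (at (x0 + s *\<^sub>R d'))"
    using f_D y_eq by (auto simp: differentiable_def)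
  ultimately show thesis
    using \<open>0 < s\<close> \<open>s < b\<close> d' by (intro that)
qed

text \<open>All admissible sequences share the limit \<open>l\<close>, so it suffices to exhibit one
  whose inner products are at least \<open>\<beta> * norm d\<close> up to a vanishing error;
  gradients near the ray provide it.\<close>

lemma minimum_of_order_1_le_semismooth_limit:
  fixes f :: "real ^ 'n \<Rightarrow> real"
  assumes "locally_lipschitz f" "minimum_of_order_1 f \<beta> xstar" "d \<noteq> 0"
    and lim: "\<And>t d' \<xi>. (t, d', \<xi>) \<in> clarke_sequences f xstar d \<Longrightarrow> (\<lambda>k. \<xi> k \<bullet> d' k) \<longlonglongrightarrow> l"
  shows "\<beta> * norm d \<le> l"
proof -
  obtain u1 L where "u1 > 0" and lip1: "L-lipschitz_on (cball xstar u1) f"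
    using assms(1) unfolding locally_lipschitz_def by blast
  obtain U where "open U" "xstar \<in> U" and U: "\<And>x. x \<in> U \<Longrightarrow> f x \<ge> f xstar + \<beta> * norm (x - xstar)"
    using assms(2) unfolding minimum_of_order_1_def by blast
  then obtain u2 where "u2 > 0" and u2: "ball xstar u2 \<subseteq> U"
    by (meson openE)
  define u where "u = min u1 u2"
  have "u > 0"
    using \<open>u1 > 0\<close> \<open>u2 > 0\<close> by (simp add: u_def)
  have lip: "L-lipschitz_on (cball xstar u) f"
    using lip1 by (rule lipschitz_on_subset) (auto simp: u_def)
  have minimum: "f x \<ge> f xstar + \<beta> * norm (x - xstar)" if "norm (x - xstar) < u" for x
    using that u2 by (intro U) (auto simp: u_def dist_norm norm_minus_commute)
  \<comment> \<open>The double successor keeps every \<open>\<epsilon> k\<close> strictly below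
    1.\<close>
  define \<epsilon> where "\<epsilon> = (\<lambda>k. inverse (real (Suc (Suc k))))"
  have \<epsilon>_lim: "\<epsilon> \<longlonglongrightarrow> 0"
    unfolding \<epsilon>_def using LIMSEQ_Suc[OF LIMSEQ_inverse_real_of_nat] .
  \<comment> \<open>Then \<open>b k * (norm d + 1)\<close> equals \<open>\<epsilon> k * u\<close>,
    which stays below \<open>u\<close>; and \<open>b\<close> tends to 0, forcing the parameters
    \<open>s k\<close> to 0.\<close>
  define b where "b = (\<lambda>k. \<epsilon> k * (u / (norm d + 1)))"
  have "norm d + 1 > 0"
    using norm_ge_zero[of d] by linarith
  have eps: "0 < \<epsilon> k" "\<epsilon> k < 1" for k
    by (auto simp: \<epsilon>_def inverse_less_1_iff)
  have b: "0 < b k" "b k * (norm d + 1) < u" for k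
    using eps[of k] \<open>u > 0\<close> \<open>norm d + 1 > 0\<close> by (auto simp: b_def)
  define C where "C = 2 * L * norm d + 3 * L + 1"
  have "\<exists>s d'. 0 < s \<and> s < b k \<and> norm (d' - d) < \<epsilon> k \<and> f differentiable (at (xstar + s *\<^sub>R d')) \<and>
      \<beta> * norm d - C * \<epsilon> k \<le> gradient f (xstar + s *\<^sub>R d') \<bullet> d'" for k
    unfolding C_def
    by (rule minimum_of_order_1_gradient_nearby[OF lip minimum eps b assms(3), of k]) blast+
  then obtain s d' where s: "\<And>k. 0 < s k" "\<And>k. s k < b k" and d': "\<And>k. norm (d' k - d) < \<epsilon> k"
    and diff: "\<And>k. f differentiable (at (xstar + s k *\<^sub>R d' k))"
    and lower: "\<And>k. \<beta> * norm d - C * \<epsilon> k \<le> gradient f (xstar + s k *\<^sub>R d' k) \<bullet> d' k"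
    by metis
  have "b \<longlonglongrightarrow> 0"
    unfolding b_def by (intro tendsto_mult_left_zero \<epsilon>_lim)
  then have "s \<longlonglongrightarrow> 0"
    by (rule tendsto_sandwich[OF _ _ tendsto_const, rotated 2]) (use s in \<open>auto intro!: always_eventually less_imp_le\<close>)
  moreover have "d' \<longlonglongrightarrow> d"
    by (intro LIM_zero_cancel[OF Lim_null_comparison[OF _ \<epsilon>_lim]] always_eventually allI less_imp_le d')
  ultimately have "(s, d', \<lambda>k. gradient f (xstar + s k *\<^sub>R d' k)) \<in> clarke_sequences f xstar d"
    using s diff by (auto simp: clarke_sequences_def intro: gradient_in_clarke_subdifferential)
  then have "(\<lambda>k. gradient f (xstar + s k *\<^sub>R d' k) \<bullet> d' k) \<longlonglongrightarrow> l"
    by (rule lim)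
  moreover have "(\<lambda>k. \<beta> * norm d - C * \<epsilon> k) \<longlonglongrightarrow> \<beta> * norm d - C * 0"
    by (intro tendsto_intros \<epsilon>_lim)
  ultimately have "\<beta> * norm d - C * 0 \<le> l"
    using lower by (intro LIMSEQ_le[rotated]) auto
  then show ?thesis
    by simp
qed

theorem lemma1:
  fixes f :: "real ^ 'n \<Rightarrow> real" and xstar :: "real ^ 'n" and \<beta> :: real
  assumes "semismooth f"
    and "\<beta> > 0"
    and "minimum_of_order_1 f \<beta> xstar"
  shows "\<forall>d :: real ^ 'n. d \<noteq> 0 \<longrightarrow> clarke_liminf f xstar d \<ge> ereal (\<beta> * norm d)"
proof (intro allI impI)
  fix d :: "real ^ 'n"
  assume "d \<noteq> 0"
  obtain l where l: "\<And>t d' \<xi>. (t, d', \<xi>) \<in> clarke_sequences f xstar d \<Longrightarrow> (\<lambda>k. \<xi> k \<bullet> d' k) \<longlonglongrightarrow> l"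
    using assms(1) unfolding semismooth_def by blast
  have "\<beta> * norm d \<le> l"
    using assms(1,3) \<open>d \<noteq> 0\<close> l
    by (intro minimum_of_order_1_le_semismooth_limit) (auto simp: semismooth_def)
  \<comment> \<open>Semismoothness turns every liminf in the infimum into the same number
    \<open>l\<close>, so a lower bound for \<open>l\<close> bounds the whole infimum.\<close>
  moreover have "liminf (\<lambda>k. ereal (\<xi> k \<bullet> d' k)) = ereal l"
    if "(t, d', \<xi>) \<in> clarke_sequences f xstar d" for t d' \<xi>
    using l[OF that] by (intro lim_imp_Liminf) auto
  ultimately show "ereal (\<beta> * norm d) \<le> clarke_liminf f xstar d"
    unfolding clarke_liminf_def by (intro INF_greatest) auto
qed

end
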